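(* Consider an independent sequence $\{Y_1,\dots,Y_n\}\subset\mathbb{M}_d$ of random matrices, and form the product $Z_n=Y_n\cdots Y_1$. Assume that $$\|\mathbb{E}Y_i\|\le m_i\quad\text{and}\quad\|Y_i-\mathbb{E}Y_i\|\le\sigma_im_i\quad\text{almost surely for } i=1,\dots,n.$$ Let $M=\prod_{i=1}^nm_i$ and $v=\sum_{i=1}^n\sigma_i^2$. Then $$\mathbb{P}\{\|Z_n\|\ge tM\}\le d\cdot\exp\Big(\frac{-\log^2t}{2v}\Big)\quad\text{when } \log t\ge2v.$$ Furthermore, $$\mathbb{P}\{\|Z_n-\mathbb{E}Z_n\|\ge tM\}\le(d\vee e)\cdot\exp\Big(\frac{-t^2}{2e^2v}\Big)\quad\text{when } t\le e.$$
   Context: $\mathbb{M}_d$ is the algebra of $d\times d$ matrices with complex entries, $\|\cdot\|$ is the spectral norm (the $\ell_2$ operator norm, i.e. the maximum singular value), $\mathbb{P}$ denotes probability and $\mathbb{E}$ expectation, and $a\vee b$ denotes the maximum of the real numbers $a$ and $b$. $e$ is Euler's number, and $\log^2t$ means $(\log t)^2$.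
   Formalization: The formal theorem assumes every m_i > 0 and, in the second bound, t ≥ 0 (t > 0 in the first); if some m_i = 0, or for very negative t, the event has probability 1 while the stated bound can be below 1. *)

theory Defs
  imports "HOL-Probability.Probability"
begin

text \<open>The vector norm on \<open>complex ^ 'd\<close> is the Euclidean one, so this is the
  \<open>\<ell>\<^sub>2\<close> operator norm. The library's own \<open>norm\<close> on the matrix type is the Frobenius norm.\<close>

definition spectral_norm :: "complex ^ 'd ^ 'd \<Rightarrow> real" where
  "spectral_norm A = onorm (\<lambda>x. A *v x)"

text \<open>\<open>rev_prod A n = A n ** \<dots> ** A 1\<close>: indices start at 1 and later factors
  multiply on the left; \<open>A 0\<close> is not used.\<close>

primrec rev_prod :: "(nat \<Rightarrow> complex ^ 'd ^ 'd) \<Rightarrow> nat \<Rightarrow> complex ^ 'd ^ 'd" where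
  "rev_prod A 0 = mat 1"
| "rev_prod A (Suc n) = A (Suc n) ** rev_prod A n"

end

theory Submission
  imports Defs
begin

text \<open>For \<open>p = 2 k\<close> put \<open>\<parallel>A\<parallel>\<^sub>p = (E tr (A\<^sup>* A)\<^sup>k)\<^sup>1\<^sup>/\<^sup>p\<close>. This norm is uniformly smooth: if \<open>Y\<close> is centered
  conditionally on \<open>X\<close>, then \<open>\<parallel>X + Y\<parallel>\<^sub>p\<^sup>2 \<le> \<parallel>X\<parallel>\<^sub>p\<^sup>2 + (p - 1) \<parallel>Y\<parallel>\<^sub>p\<^sup>2\<close>. Applied to
  \<open>Z\<^sub>i = (E Y\<^sub>i) Z\<^sub>i\<^sub>-\<^sub>1 + (Y\<^sub>i - E Y\<^sub>i) Z\<^sub>i\<^sub>-\<^sub>1\<close>, and to the same decomposition of \<open>Z\<^sub>i - E Z\<^sub>i\<close>, this gives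
  \<open>\<parallel>Z\<^sub>n\<parallel>\<^sub>p\<^sup>2 \<le> d\<^sup>2\<^sup>/\<^sup>p M\<^sup>2 exp ((p - 1) v)\<close> and \<open>\<parallel>Z\<^sub>n - E Z\<^sub>n\<parallel>\<^sub>p\<^sup>2 \<le> d\<^sup>2\<^sup>/\<^sup>p M\<^sup>2 (exp ((p - 1) v) - 1)\<close>,
  and Markov's inequality yields the tails. Even integers \<open>p\<close> suffice, since the bounds have enough slack to
  absorb the rounding of the optimal exponent. For even \<open>p\<close> all quantities are traces of words in the
  matrices and their adjoints, so that the Schatten-Hoelder inequality follows from repeated
  Cauchy-Schwarz reflections, without any spectral theory.\<close>

section \<open>Reflection positivity and real inequalities\<close>

text \<open>The chessboard argument: among the words that maximize \<open>F\<close>, reflecting the half-word that starts with the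
  longest run of a single letter makes that run longer, so some constant word is a maximizer.\<close>

lemma reflection_bound_normalized:
  fixes F :: "'l list \<Rightarrow> real"
  assumes "finite S" "k > 0"
    and rot: "\<And>w. w \<in> lists S \<Longrightarrow> length w = 2 * k \<Longrightarrow> F (rotate1 w) = F w"
    and refl: "\<And>u v. u \<in> lists S \<Longrightarrow> v \<in> lists S \<Longrightarrow> length u = k \<Longrightarrow> length v = k \<Longrightarrow>
      (F (u @ v))\<^sup>2 \<le> F (u @ rev u) * F (rev v @ v)"
    and nonneg: "\<And>w. F w \<ge> 0"
    and const: "\<And>a. a \<in> S \<Longrightarrow> F (replicate (2 * k) a) \<le> 1"
    and w: "w \<in> lists S" "length w = 2 * k"
  shows "F w \<le> 1"
proof -
  define W where "W = {w. set w \<subseteq> S \<and> length w = 2 * k}"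
  have "finite W" unfolding W_def using finite_lists_length_eq[OF \<open>finite S\<close>] .
  moreover have "w \<in> W" using w by (auto simp: W_def)
  ultimately obtain x where x: "x \<in> W" and max: "\<And>y. y \<in> W \<Longrightarrow> F y \<le> F x"
    using Max_in[of "F ` W"] Max_ge[of "F ` W"] by (metis (no_types, lifting) empty_iff finite_imageI image_iff image_is_empty)
  show ?thesis
  proof (cases "F x > 0")
    case False
    then show ?thesis using max[OF \<open>w \<in> W\<close>] by simp
  next
    case pos: True
    \<comment> \<open>Reflection turns a maximizer into a maximizer: bound the second factor in
      \<open>refl\<close> by \<open>F x\<close> and cancel \<open>F x > 0\<close>.\<close>
    have reflect: "F (u @ rev u) = F x"
      if "u @ v \<in> W" "length u = k" "F (u @ v) = F x" for u v
    proof -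
      have mem: "u \<in> lists S" "v \<in> lists S" "length v = k" "u @ rev u \<in> W" "rev v @ v \<in> W"
        using that by (auto simp: W_def)
      have "(F x)\<^sup>2 \<le> F (u @ rev u) * F (rev v @ v)"
        using refl[OF mem(1,2) that(2) mem(3)] that by simp
      also have "\<dots> \<le> F (u @ rev u) * F x"
        by (intro mult_left_mono max mem nonneg)
      finally have "F x \<le> F (u @ rev u)"
        using pos by (simp add: power2_eq_square)
      then show ?thesis using max[OF mem(4)] by simp
    qed
    have run: "\<exists>a v. replicate j a @ v \<in> W \<and> F (replicate j a @ v) = F x"
      if "1 \<le> j" "j \<le> k" for j
      using that
    proof (induction j rule: nat_induct_at_least)
      case base
      obtain a v where "x = a # v" using x \<open>k > 0\<close> by (cases x) (auto simp: W_def)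
      then show ?case using x by (intro exI[of _ a] exI[of _ v]) auto
    next
      case (Suc j)
      then obtain a v where av: "replicate j a @ v \<in> W" "F (replicate j a @ v) = F x" by auto
      define u1 where "u1 = take (k - j) v"
      define v1 where "v1 = drop (k - j) v"
      have v: "v = u1 @ v1" by (simp add: u1_def v1_def)
      have len: "length u1 = k - j" "length v = 2 * k - j"
        using av(1) Suc by (auto simp: u1_def W_def)
      have eq: "F ((replicate j a @ u1) @ rev (replicate j a @ u1)) = F x"
        using reflect[of "replicate j a @ u1" v1] av len Suc v by simp
      \<comment> \<open>The reflected word begins and ends with \<open>j\<close> copies of
        \<open>a\<close>. Rotating its final \<open>a\<close> to the front produces a run of length
        \<open>Suc j\<close>.\<close>
      let ?y = "replicate j a @ u1 @ rev u1 @ replicate (j - 1) a @ [a]"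
      have S: "a \<in> S" "set u1 \<subseteq> S" using av(1) Suc v by (auto simp: W_def)
      have y: "?y \<in> W" using S len Suc by (auto simp: W_def)
      have "rev (replicate j a) = replicate (j - 1) a @ [a]"
        using Suc(1) by (cases j) (auto simp: replicate_append_same)
      then have "F ?y = F x" using eq by (simp only: rev_append append_assoc)
      then have rx: "F (a # replicate j a @ u1 @ rev u1 @ replicate (j - 1) a) = F x"
      proof -
        let ?z = "a # replicate j a @ u1 @ rev u1 @ replicate (j - 1) a"
        have "F (rotate1 ?z) = F ?z"
          using y by (intro rot) (auto simp: W_def)
        then show ?thesis using \<open>F ?y = F x\<close> by simp
      qed
      show ?case
        by (rule exI[of _ a], rule exI[of _ "u1 @ rev u1 @ replicate (j - 1) a"])
          (use rx y in \<open>auto simp: W_def\<close>)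
    qed
    \<comment> \<open>A run of length \<open>k\<close> fills a whole half-word, so one more
      reflection gives a constant word.\<close>
    obtain a v where av: "replicate k a @ v \<in> W" "F (replicate k a @ v) = F x"
      using run[of k] \<open>k > 0\<close> by auto
    have "F (replicate k a @ rev (replicate k a)) = F x"
      by (rule reflect[OF av(1) _ av(2)]) simp
    moreover have "a \<in> S" using av \<open>k > 0\<close> by (auto simp: W_def)
    ultimately have "F x \<le> 1"
      using const[of a] by (simp add: replicate_add[symmetric] mult_2)
    then show ?thesis using max[OF \<open>w \<in> W\<close>] by simp
  qed
qed

text \<open>Dividing \<open>F\<close> by the product of the weights reduces this to the normalized
  case. The weights are enlarged to \<open>n a + e\<close> so that no divisor vanishes, and
  \<open>e\<close> tends to 0 at the end.\<close>

lemma reflection_bound: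
  fixes F :: "'l list \<Rightarrow> real" and n :: "'l \<Rightarrow> real"
  assumes k: "k > 0"
    and rot: "\<And>w. w \<in> lists S \<Longrightarrow> length w = 2 * k \<Longrightarrow> F (rotate1 w) = F w"
    and refl: "\<And>u v. u \<in> lists S \<Longrightarrow> v \<in> lists S \<Longrightarrow> length u = k \<Longrightarrow> length v = k \<Longrightarrow>
      (F (u @ v))\<^sup>2 \<le> F (u @ rev u) * F (rev v @ v)"
    and nonneg: "\<And>w. F w \<ge> 0"
    and n: "\<And>a. a \<in> S \<Longrightarrow> n a \<ge> 0"
    and const: "\<And>a. a \<in> S \<Longrightarrow> F (replicate (2 * k) a) \<le> n a ^ (2 * k)"
    and w: "w \<in> lists S" "length w = 2 * k"
  shows "F w \<le> prod_list (map n w)"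
proof -
  have eps: "F w \<le> prod_list (map (\<lambda>a. n a + e) w)" if "e > 0" for e
  proof -
    define N where "N w = prod_list (map (\<lambda>a. n a + e) w)" for w
    have N_app: "N (u @ v) = N u * N v" "N (rev u) = N u" for u v
      by (simp_all add: N_def prod_list.rev flip: rev_map)
    have Npos: "N u > 0" if "set u \<subseteq> S" for u
      using that n \<open>e > 0\<close> by (induction u) (auto simp: N_def add_nonneg_pos)
    have N1: "N (rotate1 u) = N u" for u by (cases u) (auto simp: N_def)
    have Nrep: "N (replicate j a) = (n a + e) ^ j" for a j by (induction j) (auto simp: N_def)
    \<comment> \<open>The absolute value keeps the quotient nonnegative for all words, including
      those with letters outside \<open>S\<close>, whose weights may be negative.\<close>
    define N' where "N' u = \<bar>N u\<bar>" for u
    \<comment> \<open>The letters of \<open>w\<close> serve as the finite alphabet.\<close>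
    have "F w / N' w \<le> 1"
    proof (rule reflection_bound_normalized[where F = "\<lambda>w. F w / N' w" and S = "set w" and k = k])
      show "F (rotate1 u) / N' (rotate1 u) = F u / N' u"
        if "u \<in> lists (set w)" "length u = 2 * k" for u
        using rot[of u] that w by (auto simp: N1 N'_def)
    next
      fix u v assume uv: "u \<in> lists (set w)" "v \<in> lists (set w)" "length u = k" "length v = k"
      then have "set u \<subseteq> S" "set v \<subseteq> S" using w by auto
      note pos = Npos[OF this(1)] Npos[OF this(2)]
      have "(F (u @ v))\<^sup>2 / (N u * N v)\<^sup>2 \<le> F (u @ rev u) * F (rev v @ v) / (N u * N v)\<^sup>2"
        using \<open>set u \<subseteq> S\<close> \<open>set v \<subseteq> S\<close> uv by (intro divide_right_mono refl) auto
      then show "(F (u @ v) / N' (u @ v))\<^sup>2 \<le> F (u @ rev u) / N' (u @ rev u) * (F (rev v @ v) / N' (rev v @ v))"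
        using pos by (simp add: N_app power_divide N'_def power2_eq_square mult.commute mult.left_commute)
    next
      fix a assume a: "a \<in> set w"
      then have aS: "a \<in> S" using w by auto
      have "F (replicate (2 * k) a) \<le> n a ^ (2 * k)" using const[OF aS] .
      also have "\<dots> \<le> (n a + e) ^ (2 * k)" using n[OF aS] that by (intro power_mono) auto
      finally show "F (replicate (2 * k) a) / N' (replicate (2 * k) a) \<le> 1"
        using n[OF aS] that by (simp add: Nrep N'_def)
    qed (use k w nonneg in \<open>auto simp: N'_def\<close>)
    moreover have "N w > 0" using Npos[of w] w by auto
    then have "N' w = N w" by (simp add: N'_def)
    ultimately show ?thesis using \<open>N w > 0\<close> by (simp add: N_def)
  qed
  have "((\<lambda>e. prod_list (map (\<lambda>a. n a + e) u)) \<longlongrightarrow> prod_list (map (\<lambda>a. n a + 0) u)) (at_right 0)" for u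
    by (induction u) (auto intro!: tendsto_eq_intros simp del: add_0_right)
  from this[of w] have lim: "((\<lambda>e. prod_list (map (\<lambda>a. n a + e) w)) \<longlongrightarrow> prod_list (map n w)) (at_right 0)"
    by simp
  show ?thesis
    by (rule tendsto_lowerbound[OF lim])
      (auto intro: eventually_mono[OF eventually_at_right_less[of 0]] eps)
qed

text \<open>A discrete form of integrating \<phi>'' \<le> 2 K twice, starting from a minimum at 0
  where the slope vanishes. A grid of width \<open>h\<close> gives the bound with K (1 + h), and
  then \<open>h\<close> tends to 0.\<close>

lemma tangent_parabola_bound:
  fixes \<phi> :: "real \<Rightarrow> real"
  assumes mid: "\<And>s h. \<phi> (s + h) + \<phi> (s - h) \<le> 2 * \<phi> s + 2 * (K * h\<^sup>2)"
    and low: "\<And>s. \<phi> 0 \<le> \<phi> s"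
  shows "\<phi> 1 \<le> \<phi> 0 + K"
proof -
  have grid: "\<phi> 1 \<le> \<phi> 0 + K * (1 + inverse (real (Suc N)))" for N
  proof -
    define h where "h = inverse (real (Suc N))"
    \<comment> \<open>The first increment is at most 2 K h^2 because 0 is a minimum, and
      \<open>mid\<close> lets each later one grow by at most the same amount. Summing the increments
      gives the second bound.\<close>
    have *: "\<phi> (real (Suc j) * h) - \<phi> (real j * h) \<le> 2 * K * h\<^sup>2 * real (Suc j)
        \<and> \<phi> (real j * h) - \<phi> 0 \<le> K * h\<^sup>2 * (real j * real (Suc j))" for j
    proof (induction j)
      case 0
      show ?case using mid[of 0 h] low[of "-h"] by simp
    next
      case (Suc j)
      have "real (Suc j) * h + h = real (Suc (Suc j)) * h" "real (Suc j) * h - h = real j * h"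
        by (simp_all add: algebra_simps)
      then have "\<phi> (real (Suc (Suc j)) * h) + \<phi> (real j * h) \<le> 2 * \<phi> (real (Suc j) * h) + 2 * (K * h\<^sup>2)"
        using mid[of "real (Suc j) * h" h] by metis
      then show ?case using Suc by (auto simp: algebra_simps)
    qed
    have h1: "real (Suc N) * h = 1" by (simp add: h_def)
    have "\<phi> 1 - \<phi> 0 \<le> K * h\<^sup>2 * (real (Suc N) * real (Suc (Suc N)))"
      using *[of "Suc N"] unfolding h1 by blast
    also have "\<dots> = K * (real (Suc N) * h) * (real (Suc N) * h + h)"
      by (simp add: algebra_simps power2_eq_square)
    also have "\<dots> = K * (1 + h)" unfolding h1 by simp
    finally show ?thesis by (simp add: h_def)
  qed
  have "(\<lambda>N. \<phi> 0 + K * (1 + inverse (real (Suc N)))) \<longlonglongrightarrow> \<phi> 0 + K * (1 + 0)"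
    by (intro tendsto_intros LIMSEQ_inverse_real_of_nat)
  then show ?thesis
    using grid by (intro LIMSEQ_le_const[where X = "\<lambda>N. \<phi> 0 + K * (1 + inverse (real (Suc N)))"]) auto
qed

text \<open>From \<open>i\<close> to \<open>i + 1\<close> the left side is multiplied by (k - i) /
  (i + 1) times (2 k - 2 i - 1) / (2 i + 1), the right side by (k - i) / (i + 1) times 2 k - 1,
  which is at least as large.\<close>

lemma binomial_even_le: "i \<le> k \<Longrightarrow> (2 * k) choose (2 * i) \<le> (k choose i) * (2 * k - 1) ^ i"
proof (induction i)
  case (Suc i)
  have step: "Suc j * (N choose Suc j) = (N - j) * (N choose j)" for N j
    by (simp only: binomial_absorption binomial_absorb_comp)
  have a: "(2 * i + 1) * (2 * k choose (2 * i + 1)) = 2 * (k - i) * (2 * k choose (2 * i))"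
    using step[of "2 * i" "2 * k"] by (simp only: Suc_eq_plus1 diff_mult_distrib2)
  have b: "2 * (i + 1) * (2 * k choose (2 * i + 2)) = (2 * k - 2 * i - 1) * (2 * k choose (2 * i + 1))"
    using step[of "2 * i + 1" "2 * k"] by simp
  have c: "(i + 1) * (k choose (i + 1)) = (k - i) * (k choose i)"
    using step[of i k] by simp
  have IH: "(2 * k) choose (2 * i) \<le> (k choose i) * (2 * k - 1) ^ i" using Suc by simp
  \<comment> \<open>Multiplying two recursions eliminates the odd binomial coefficient between them,
    without division in the naturals.\<close>
  have chain: "p * q * z = r * s * x" if "p * y = s * x" "q * z = r * y" for p q r s x y z :: nat
    using that by (metis mult.assoc mult.left_commute)
  have "(2 * i + 1) * (2 * (i + 1)) * (2 * k choose (2 * i + 2))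
      = (2 * k - 2 * i - 1) * (2 * (k - i)) * (2 * k choose (2 * i))"
    by (rule chain[OF a b])
  also have "\<dots> \<le> (2 * k - 2 * i - 1) * (2 * (k - i)) * ((k choose i) * (2 * k - 1) ^ i)"
    using IH by (rule mult_left_mono) simp
  also have "\<dots> = (2 * k - 2 * i - 1) * (2 * ((i + 1) * (k choose (i + 1)))) * (2 * k - 1) ^ i"
    unfolding c by (simp only: mult.assoc)
  also have "\<dots> \<le> ((2 * i + 1) * (2 * k - 1)) * (2 * ((i + 1) * (k choose (i + 1)))) * (2 * k - 1) ^ i"
  proof (intro mult_right_mono)
    have "2 * k - 2 * i - 1 \<le> 1 * (2 * k - 1)" by simp
    also have "\<dots> \<le> (2 * i + 1) * (2 * k - 1)" by (rule mult_right_mono) simp_all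
    finally show "2 * k - 2 * i - 1 \<le> (2 * i + 1) * (2 * k - 1)" .
  qed simp_all
  also have "\<dots> = (2 * i + 1) * (2 * (i + 1)) * ((k choose (i + 1)) * (2 * k - 1) ^ (i + 1))"
    by (simp only: power_add power_one_right mult_ac)
  finally have "2 * k choose (2 * i + 2) \<le> (k choose (i + 1)) * (2 * k - 1) ^ (i + 1)"
    by (subst (asm) mult_le_cancel1) simp
  then show ?case by simp
qed simp

text \<open>The scalar source of the constant p - 1 with p = 2 k. Averaging cancels the odd powers
  of \<open>y\<close>, and the even ones are compared term by term with the binomial expansion on
  the right.\<close>

lemma two_point_power_le:
  fixes x y :: real
  assumes "k > 0"
  shows "((x + y) ^ (2 * k) + (x - y) ^ (2 * k)) / 2 \<le> (x\<^sup>2 + (2 * real k - 1) * y\<^sup>2) ^ k"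
proof -
  have "(x + y) ^ (2 * k) + (x - y) ^ (2 * k)
      = (\<Sum>j\<le>2 * k. real (2 * k choose j) * (y ^ j + (- y) ^ j) * x ^ (2 * k - j))"
    using binomial_ring[of y x "2 * k"] binomial_ring[of "- y" x "2 * k"]
    by (simp add: sum.distrib[symmetric] algebra_simps)
  also have "\<dots> = (\<Sum>j\<in>(\<lambda>i. 2 * i) ` {..k}. real (2 * k choose j) * (y ^ j + (- y) ^ j) * x ^ (2 * k - j))"
  proof (rule sum.mono_neutral_right)
    show "\<forall>i\<in>{..2 * k} - (*) 2 ` {..k}. real (2 * k choose i) * (y ^ i + (- y) ^ i) * x ^ (2 * k - i) = 0"
    proof
      fix i assume "i \<in> {..2 * k} - (*) 2 ` {..k}"
      then have "odd i" by (auto elim!: evenE)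
      then show "real (2 * k choose i) * (y ^ i + (- y) ^ i) * x ^ (2 * k - i) = 0" by simp
    qed
  qed auto
  also have "\<dots> = (\<Sum>i\<le>k. real (2 * k choose (2 * i)) * (2 * y ^ (2 * i)) * x ^ (2 * k - 2 * i))"
    by (subst sum.reindex) (auto simp: inj_on_def)
  finally have "((x + y) ^ (2 * k) + (x - y) ^ (2 * k)) / 2
      = (\<Sum>i\<le>k. real (2 * k choose (2 * i)) * y ^ (2 * i) * x ^ (2 * k - 2 * i))"
    by (simp add: sum_divide_distrib mult.assoc)
  also have "\<dots> \<le> (\<Sum>i\<le>k. real (k choose i) * ((2 * real k - 1) * y\<^sup>2) ^ i * (x\<^sup>2) ^ (k - i))"
  proof (rule sum_mono)
    fix i assume "i \<in> {..k}"
    have "real (2 * k choose (2 * i)) \<le> real ((k choose i) * (2 * k - 1) ^ i)"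
      using binomial_even_le[of i k] \<open>i \<in> {..k}\<close> by (subst of_nat_le_iff) simp
    also have "\<dots> = real (k choose i) * (2 * real k - 1) ^ i"
      using assms by (simp add: of_nat_diff)
    finally have "real (2 * k choose (2 * i)) * (y\<^sup>2) ^ i * (x\<^sup>2) ^ (k - i)
        \<le> real (k choose i) * (2 * real k - 1) ^ i * (y\<^sup>2) ^ i * (x\<^sup>2) ^ (k - i)"
      by (intro mult_right_mono) auto
    then show "real (2 * k choose (2 * i)) * y ^ (2 * i) * x ^ (2 * k - 2 * i)
        \<le> real (k choose i) * ((2 * real k - 1) * y\<^sup>2) ^ i * (x\<^sup>2) ^ (k - i)"
      by (simp add: power_mult[symmetric] power_mult_distrib diff_mult_distrib2 mult.assoc)
  qed
  also have "\<dots> = (x\<^sup>2 + (2 * real k - 1) * y\<^sup>2) ^ k"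
    using binomial_ring[of "(2 * real k - 1) * y\<^sup>2" "x\<^sup>2" k] by (simp add: add.commute)
  finally show ?thesis .
qed

section \<open>Alternating products of matrices\<close>

definition ctranspose :: "complex ^ 'm ^ 'n \<Rightarrow> complex ^ 'n ^ 'm" where
  "ctranspose A = (\<chi> i j. cnj (A $ j $ i))"

lemma ctranspose_ctranspose [simp]: "ctranspose (ctranspose A) = A"
  by (simp add: ctranspose_def vec_eq_iff)

lemma ctranspose_mult: "ctranspose (A ** B) = ctranspose B ** ctranspose A"
  by (simp add: ctranspose_def vec_eq_iff matrix_matrix_mult_def mult.commute)

lemma ctranspose_mat_1 [simp]: "ctranspose (mat 1) = mat 1"
  by (simp add: ctranspose_def vec_eq_iff mat_def)

lemma bounded_linear_ctranspose: "bounded_linear (ctranspose :: complex ^ 'm ^ 'n \<Rightarrow> _)"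
  by (rule linear_conv_bounded_linear[THEN iffD1], rule linearI)
    (auto simp: ctranspose_def vec_eq_iff)

lemma inner_ctranspose: "ctranspose A \<bullet> ctranspose B = A \<bullet> B"
  unfolding inner_vec_def ctranspose_def
  by (simp add: inner_complex_def) (rule sum.swap)

text \<open>The real inner product of matrices is Re tr (A^* B), so a left factor passes to the
  other side as its adjoint.\<close>

lemma inner_matrix_mult_left:
  fixes A :: "complex ^ 'm ^ 'n" and B :: "complex ^ 'p ^ 'm"
  shows "(A ** B) \<bullet> C = B \<bullet> (ctranspose A ** C)"
proof -
  have cnj: "(a * b) \<bullet> c = b \<bullet> (cnj a * c)" for a b c :: complex
    by (simp add: inner_complex_def algebra_simps)
  have "(A ** B) \<bullet> C = (\<Sum>i\<in>UNIV. \<Sum>j\<in>UNIV. \<Sum>l\<in>UNIV. (A $ i $ l * B $ l $ j) \<bullet> C $ i $ j)"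
    by (simp add: inner_vec_def matrix_matrix_mult_def inner_sum_left)
  also have "\<dots> = (\<Sum>i\<in>UNIV. \<Sum>l\<in>UNIV. \<Sum>j\<in>UNIV. (A $ i $ l * B $ l $ j) \<bullet> C $ i $ j)"
    by (intro sum.cong refl sum.swap)
  also have "\<dots> = (\<Sum>l\<in>UNIV. \<Sum>i\<in>UNIV. \<Sum>j\<in>UNIV. (A $ i $ l * B $ l $ j) \<bullet> C $ i $ j)"
    by (rule sum.swap)
  also have "\<dots> = (\<Sum>l\<in>UNIV. \<Sum>j\<in>UNIV. \<Sum>i\<in>UNIV. (A $ i $ l * B $ l $ j) \<bullet> C $ i $ j)"
    by (intro sum.cong refl sum.swap)
  also have "\<dots> = B \<bullet> (ctranspose A ** C)"
    by (simp add: inner_vec_def matrix_matrix_mult_def inner_sum_right cnj ctranspose_def)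
  finally show ?thesis .
qed

lemma inner_matrix_mult_right: "(A ** B) \<bullet> C = A \<bullet> (C ** ctranspose B)"
proof -
  have "(A ** B) \<bullet> C = (ctranspose B ** ctranspose A) \<bullet> ctranspose C"
    by (metis inner_ctranspose ctranspose_mult)
  also have "\<dots> = ctranspose A \<bullet> (B ** ctranspose C)"
    by (simp add: inner_matrix_mult_left)
  also have "\<dots> = A \<bullet> (C ** ctranspose B)"
    by (metis inner_ctranspose ctranspose_mult ctranspose_ctranspose)
  finally show ?thesis .
qed

lemma trace_mult_eq_inner: "mat 1 \<bullet> (A ** B) = ctranspose A \<bullet> B"
  by (metis inner_commute inner_matrix_mult_left inner_matrix_mult_right matrix_mul_rid matrix_mul_lid)

lemma trace_mult_commute:
  fixes A :: "complex ^ 'd ^ 'd"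
  shows "mat 1 \<bullet> (A ** B) = mat 1 \<bullet> (B ** A)"
  by (metis trace_mult_eq_inner inner_commute inner_ctranspose ctranspose_ctranspose)

lemma bounded_bilinear_matrix_mult:
  "bounded_bilinear ((**) :: complex ^ 'm ^ 'n \<Rightarrow> complex ^ 'p ^ 'm \<Rightarrow> _)"
proof (rule bilinear_conv_bounded_bilinear[THEN iffD1])
  show "bilinear ((**) :: complex ^ 'm ^ 'n \<Rightarrow> complex ^ 'p ^ 'm \<Rightarrow> _)"
    unfolding bilinear_def
    by (intro allI conjI linearI)
      (auto simp: vec_eq_iff matrix_matrix_mult_def algebra_simps sum.distrib scaleR_sum_right)
qed

text \<open>The squared Frobenius norm is the sum of the squared Euclidean norms of the columns, and
  \<open>C\<close> acts on each column separately.\<close>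

lemma norm_matrix_mult_le:
  fixes C B :: "complex ^ 'd ^ 'd"
  assumes "spectral_norm C \<le> c"
  shows "norm (C ** B) \<le> c * norm B"
proof -
  have cols: "(norm A)\<^sup>2 = (\<Sum>j\<in>UNIV. (norm (column j A))\<^sup>2)" for A :: "complex ^ 'd ^ 'd"
    unfolding power2_norm_eq_inner inner_vec_def column_def by (simp, rule sum.swap)
  have on: "norm (C *v x) \<le> c * norm x" for x
  proof -
    have "norm (C *v x) \<le> onorm ((*v) C) * norm x"
      by (rule onorm) simp
    also have "\<dots> \<le> c * norm x"
      using assms by (intro mult_right_mono) (auto simp: spectral_norm_def)
    finally show ?thesis .
  qed
  have c: "0 \<le> c"
    using assms onorm_pos_le[OF matrix_vector_mul_bounded_linear, of C] by (simp add: spectral_norm_def)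
  have "(norm (C ** B))\<^sup>2 = (\<Sum>j\<in>UNIV. (norm (C *v column j B))\<^sup>2)"
    unfolding cols by (simp add: column_def matrix_matrix_mult_def matrix_vector_mult_def)
  also have "\<dots> \<le> (\<Sum>j\<in>UNIV. (c * norm (column j B))\<^sup>2)"
    by (intro sum_mono power_mono on) auto
  also have "\<dots> = (c * norm B)\<^sup>2"
    by (simp add: power_mult_distrib cols sum_distrib_left)
  finally show ?thesis
    by (rule power2_le_imp_le) (use c in simp)
qed

section \<open>Words with alternating adjoints\<close>

fun alt_prod :: "bool \<Rightarrow> (complex ^ 'd ^ 'd) list \<Rightarrow> complex ^ 'd ^ 'd" where
  "alt_prod s [] = mat 1"
| "alt_prod s (A # w) = (if s then ctranspose A else A) ** alt_prod (\<not> s) w"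

lemma alt_prod_append:
  "alt_prod s (u @ v) = alt_prod s u ** alt_prod (s \<noteq> odd (length u)) v"
  by (induction u arbitrary: s) (auto simp: matrix_mul_assoc)

lemma ctranspose_alt_prod: "ctranspose (alt_prod s w) = alt_prod (s \<noteq> odd (length w)) (rev w)"
  by (induction w arbitrary: s) (auto simp: alt_prod_append ctranspose_mult)

text \<open>Cyclicity of the trace. Since the length is even, the letter moved to the end keeps its
  adjoint status when the starting flag is flipped.\<close>

lemma trace_alt_prod_rotate1:
  assumes "even (length w)"
  shows "mat 1 \<bullet> alt_prod s w = mat 1 \<bullet> alt_prod (\<not> s) (rotate1 w)"
  using assms by (cases w) (auto simp: alt_prod_append trace_mult_commute)

text \<open>Both half-words receive the same flag, so Cauchy-Schwarz applied to this inner product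
  again yields traces of alternating words.\<close>

lemma trace_alt_prod_append:
  assumes "length u = k"
  shows "mat 1 \<bullet> alt_prod s (u @ v)
    = alt_prod (s \<noteq> odd k) (rev u) \<bullet> alt_prod (s \<noteq> odd k) v"
  using assms by (simp add: alt_prod_append trace_mult_eq_inner ctranspose_alt_prod)

lemma alt_prod_linear_last:
  "alt_prod s (w @ [A + B]) = alt_prod s (w @ [A]) + alt_prod s (w @ [B])"
  "alt_prod s (w @ [c *\<^sub>R A]) = c *\<^sub>R alt_prod s (w @ [A])"
  by (auto simp: alt_prod_append bounded_linear.linear[OF bounded_linear_ctranspose] linear_add linear_scale
      bounded_bilinear.add_right[OF bounded_bilinear_matrix_mult]
      bounded_bilinear.scaleR_right[OF bounded_bilinear_matrix_mult])

lemma alt_prod_replicate_scaleR: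
  "alt_prod s (replicate n (c *\<^sub>R A)) = c ^ n *\<^sub>R alt_prod s (replicate n A)"
  by (induction n arbitrary: s)
    (auto simp: bounded_linear.linear[OF bounded_linear_ctranspose] linear_scale
      bounded_bilinear.scaleR_left[OF bounded_bilinear_matrix_mult]
      bounded_bilinear.scaleR_right[OF bounded_bilinear_matrix_mult] mult.commute)

lemma lists_length_Suc_eq: "{w :: 'b::finite list. length w = Suc n} = (\<lambda>(b, w). b # w) ` (UNIV \<times> {w. length w = n})"
  by (auto simp: length_Suc_conv image_iff)

text \<open>Noncommutative binomial expansion, indexed by Boolean words in which \<open>True\<close>
  selects \<open>B\<close>. The scalar counterpart \<open>power_add_eq_sum_words\<close> uses the
  same index set, so the two can be compared word by word.\<close>

lemma alt_prod_replicate_add: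
  "alt_prod s (replicate n (A + c *\<^sub>R B))
    = (\<Sum>w | length w = n. c ^ count_list w True *\<^sub>R alt_prod s (map (\<lambda>b. if b then B else A) w))"
proof (induction n arbitrary: s)
  case 0
  then show ?case by simp
next
  case (Suc n)
  interpret mm: bounded_bilinear "(**) :: complex ^ 'd ^ 'd \<Rightarrow> complex ^ 'd ^ 'd \<Rightarrow> _"
    by (rule bounded_bilinear_matrix_mult)
  have "(\<Sum>w | length w = Suc n. c ^ count_list w True *\<^sub>R alt_prod s (map (\<lambda>b. if b then B else A) w))
      = (\<Sum>b\<in>UNIV. \<Sum>w | length w = n. c ^ count_list (b # w) True *\<^sub>R alt_prod s (map (\<lambda>b. if b then B else A) (b # w)))"
    unfolding lists_length_Suc_eq
    by (subst sum.reindex) (auto simp: inj_on_def sum.cartesian_product intro!: sum.cong)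
  also have "\<dots> = alt_prod s (replicate (Suc n) (A + c *\<^sub>R B))"
    by (simp add: UNIV_bool Suc mm.add_left mm.scaleR_left mm.sum_right mm.scaleR_right
      bounded_linear.linear[OF bounded_linear_ctranspose] linear_add linear_scale sum.distrib
      scaleR_sum_right mult.commute)
  finally show ?case by simp
qed

lemma power_add_eq_sum_words:
  fixes a b :: real
  shows "(a + c * b) ^ n = (\<Sum>w | length w = n. c ^ count_list w True * prod_list (map (\<lambda>t. if t then b else a) w))"
proof (induction n)
  case 0
  then show ?case by simp
next
  case (Suc n)
  have "(\<Sum>w | length w = Suc n. c ^ count_list w True * prod_list (map (\<lambda>t. if t then b else a) w))
      = (\<Sum>t\<in>UNIV. \<Sum>w | length w = n. c ^ count_list (t # w) True * prod_list (map (\<lambda>t. if t then b else a) (t # w)))"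
    unfolding lists_length_Suc_eq
    by (subst sum.reindex) (auto simp: inj_on_def sum.cartesian_product intro!: sum.cong)
  also have "\<dots> = a * (\<Sum>w | length w = n. c ^ count_list w True * prod_list (map (\<lambda>t. if t then b else a) w))
      + (c * b) * (\<Sum>w | length w = n. c ^ count_list w True * prod_list (map (\<lambda>t. if t then b else a) w))"
    by (simp add: UNIV_bool sum_distrib_left mult_ac)
  also have "\<dots> = (a + c * b) ^ Suc n"
    by (simp add: Suc distrib_right)
  finally show ?case by simp
qed

section \<open>Uniform smoothness of Schatten norms of random matrices\<close>

context prob_space
begin

section \<open>Essentially bounded random variables\<close>

definition ess_bounded :: "('a \<Rightarrow> 'b::euclidean_space) \<Rightarrow> bool" where
  "ess_bounded A \<longleftrightarrow> A \<in> borel_measurable M \<and> (\<exists>c. AE \<omega> in M. norm (A \<omega>) \<le> c)"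

lemma ess_boundedI: "A \<in> borel_measurable M \<Longrightarrow> AE \<omega> in M. norm (A \<omega>) \<le> c \<Longrightarrow> ess_bounded A"
  by (auto simp: ess_bounded_def)

lemma ess_bounded_const [intro, simp]: "ess_bounded (\<lambda>_. c)"
  by (rule ess_boundedI[where c = "norm c"]) auto

lemma ess_bounded_add [intro]:
  assumes "ess_bounded A" "ess_bounded B"
  shows "ess_bounded (\<lambda>\<omega>. A \<omega> + B \<omega>)"
proof -
  obtain a b where ab: "AE \<omega> in M. norm (A \<omega>) \<le> a" "AE \<omega> in M. norm (B \<omega>) \<le> b"
    using assms by (auto simp: ess_bounded_def)
  show ?thesis
  proof (rule ess_boundedI)
    show "AE \<omega> in M. norm (A \<omega> + B \<omega>) \<le> a + b"
      using ab by eventually_elim (meson add_mono norm_triangle_ineq order_trans)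
  qed (use assms in \<open>auto simp: ess_bounded_def\<close>)
qed

lemma ess_bounded_linear:
  assumes f: "bounded_linear f" and "ess_bounded A"
  shows "ess_bounded (\<lambda>\<omega>. f (A \<omega>))"
proof -
  obtain a where a: "AE \<omega> in M. norm (A \<omega>) \<le> a"
    using assms by (auto simp: ess_bounded_def)
  obtain K where K: "0 < K" "\<And>x. norm (f x) \<le> norm x * K"
    using bounded_linear.pos_bounded[OF f] by blast
  show ?thesis
  proof (rule ess_boundedI)
    show "AE \<omega> in M. norm (f (A \<omega>)) \<le> a * K"
      using a by eventually_elim (use K in \<open>meson mult_right_mono less_imp_le order_trans\<close>)
    show "(\<lambda>\<omega>. f (A \<omega>)) \<in> borel_measurable M"
      using assms(2) linear_continuous_on[OF f, of UNIV]
      by (intro borel_measurable_continuous_on[of f]) (auto simp: ess_bounded_def)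
  qed
qed

lemma ess_bounded_bilinear:
  assumes f: "bounded_bilinear f" and "ess_bounded A" "ess_bounded B"
  shows "ess_bounded (\<lambda>\<omega>. f (A \<omega>) (B \<omega>))"
proof -
  obtain a b where ab: "AE \<omega> in M. norm (A \<omega>) \<le> a" "AE \<omega> in M. norm (B \<omega>) \<le> b"
    using assms by (auto simp: ess_bounded_def)
  obtain K where K: "0 < K" "\<And>x y. norm (f x y) \<le> norm x * norm y * K"
    using bounded_bilinear.pos_bounded[OF f] by blast
  show ?thesis
  proof (rule ess_boundedI)
    show "AE \<omega> in M. norm (f (A \<omega>) (B \<omega>)) \<le> a * b * K"
      using ab
    proof eventually_elim
      case (elim \<omega>)
      have "norm (f (A \<omega>) (B \<omega>)) \<le> norm (A \<omega>) * norm (B \<omega>) * K" by (rule K)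
      also have "\<dots> \<le> a * b * K"
        using elim K(1) order_trans[OF norm_ge_zero elim(1)] order_trans[OF norm_ge_zero elim(2)] by (intro mult_mono mult_nonneg_nonneg) auto
      finally show ?case .
    qed
    show "(\<lambda>\<omega>. f (A \<omega>) (B \<omega>)) \<in> borel_measurable M"
    proof (rule borel_measurable_continuous_Pair[where H = f])
      show "continuous_on UNIV (\<lambda>x. f (fst x) (snd x))"
        by (rule bounded_bilinear.continuous_on[OF f]) (intro continuous_intros)+
    qed (use assms in \<open>auto simp: ess_bounded_def\<close>)
  qed
qed

lemma ess_bounded_scaleR [intro]: "ess_bounded A \<Longrightarrow> ess_bounded (\<lambda>\<omega>. c *\<^sub>R A \<omega>)"
  by (rule ess_bounded_linear[OF bounded_linear_scaleR_right])

lemma ess_bounded_diff [intro]: "ess_bounded A \<Longrightarrow> ess_bounded B \<Longrightarrow> ess_bounded (\<lambda>\<omega>. A \<omega> - B \<omega>)"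
  using ess_bounded_add[OF _ ess_bounded_scaleR[of B "-1"], of A] by simp

lemma ess_bounded_matrix_mult [intro]: "ess_bounded A \<Longrightarrow> ess_bounded B \<Longrightarrow> ess_bounded (\<lambda>\<omega>. A \<omega> ** B \<omega>)"
  for A B :: "'a \<Rightarrow> complex ^ 'd ^ 'd"
  by (rule ess_bounded_bilinear[OF bounded_bilinear_matrix_mult])

lemma ess_bounded_inner [intro]: "ess_bounded A \<Longrightarrow> ess_bounded B \<Longrightarrow> ess_bounded (\<lambda>\<omega>. A \<omega> \<bullet> B \<omega>)"
  by (rule ess_bounded_bilinear[OF bounded_bilinear_inner])

lemma ess_bounded_alt_prod [intro]:
  "(\<And>A. A \<in> set w \<Longrightarrow> ess_bounded A) \<Longrightarrow> ess_bounded (\<lambda>\<omega>. alt_prod s (map (\<lambda>A. A \<omega>) w))"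
proof (induction w arbitrary: s)
  case (Cons A w)
  have "ess_bounded (\<lambda>\<omega>. if s then ctranspose (A \<omega>) else A \<omega>)"
    using Cons.prems by (cases s) (auto intro: ess_bounded_linear[OF bounded_linear_ctranspose])
  then show ?case using Cons by auto
qed simp

lemma ess_bounded_integrable [intro]: "ess_bounded A \<Longrightarrow> integrable M A"
  unfolding ess_bounded_def by (auto intro: integrable_const_bound)

lemma expectation_inner_Cauchy_Schwarz:
  fixes A B :: "'a \<Rightarrow> 'b::euclidean_space"
  assumes AB: "ess_bounded A" "ess_bounded B"
  shows "(expectation (\<lambda>\<omega>. A \<omega> \<bullet> B \<omega>))\<^sup>2
    \<le> expectation (\<lambda>\<omega>. (norm (A \<omega>))\<^sup>2) * expectation (\<lambda>\<omega>. (norm (B \<omega>))\<^sup>2)"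
proof -
  define a where "a = expectation (\<lambda>\<omega>. A \<omega> \<bullet> A \<omega>)"
  define b where "b = expectation (\<lambda>\<omega>. A \<omega> \<bullet> B \<omega>)"
  define c where "c = expectation (\<lambda>\<omega>. B \<omega> \<bullet> B \<omega>)"
  have int: "integrable M (\<lambda>\<omega>. A \<omega> \<bullet> A \<omega>)" "integrable M (\<lambda>\<omega>. A \<omega> \<bullet> B \<omega>)" "integrable M (\<lambda>\<omega>. B \<omega> \<bullet> B \<omega>)"
    using AB by auto
  have quad: "0 \<le> a + 2 * t * b + t\<^sup>2 * c" for t
  proof -
    have "0 \<le> expectation (\<lambda>\<omega>. (A \<omega> + t *\<^sub>R B \<omega>) \<bullet> (A \<omega> + t *\<^sub>R B \<omega>))"
      by (intro integral_nonneg_AE) auto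
    also have "\<dots> = expectation (\<lambda>\<omega>. A \<omega> \<bullet> A \<omega> + (2 * t) * (A \<omega> \<bullet> B \<omega>) + t\<^sup>2 * (B \<omega> \<bullet> B \<omega>))"
      by (intro Bochner_Integration.integral_cong)
        (auto simp: inner_add_left inner_add_right inner_commute power2_eq_square)
    also have "\<dots> = a + 2 * t * b + t\<^sup>2 * c"
      using int by (simp add: a_def b_def c_def)
    finally show ?thesis .
  qed
  have c0: "0 \<le> c" unfolding c_def by (intro integral_nonneg_AE) auto
  have "b\<^sup>2 \<le> a * c"
  proof (cases "c = 0")
    case True
    \<comment> \<open>With \<open>c = 0\<close> the quadratic is affine in \<open>t\<close>; for
      \<open>b\<close> nonzero the chosen \<open>t\<close> would give it the value -1.\<close>
    have "b = 0"
    proof (rule ccontr)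
      assume "b \<noteq> 0"
      then show False using quad[of "- (a + 1) / (2 * b)"] True by (simp add: field_simps)
    qed
    then show ?thesis using True by simp
  next
    case False
    \<comment> \<open>The value -b/c of \<open>t\<close> minimizes the quadratic.\<close>
    then have "0 \<le> (a + 2 * (- b / c) * b + (- b / c)\<^sup>2 * c) * c"
      using quad[of "- b / c"] c0 by (intro mult_nonneg_nonneg)
    also have "\<dots> = a * c - b\<^sup>2" using False by (simp add: field_simps power2_eq_square)
    finally show ?thesis by simp
  qed
  then show ?thesis by (simp add: a_def b_def c_def power2_norm_eq_inner)
qed

text \<open>The inner product with \<open>mat 1\<close> is the real part of the trace, so the moments below are those of the words
  \<open>A\<^sub>1\<^sup>* A\<^sub>2 A\<^sub>3\<^sup>* A\<^sub>4 \<dots>\<close> or \<open>A\<^sub>1 A\<^sub>2\<^sup>* A\<^sub>3 A\<^sub>4\<^sup>* \<dots>\<close>, and \<open>schatten_norm k\<close> is the norm of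
  \<open>L\<^sub>p(\<Omega>; S\<^sub>p)\<close> for \<open>p = 2 k\<close>.\<close>

definition word_moment :: "bool \<Rightarrow> ('a \<Rightarrow> complex ^ 'd ^ 'd) list \<Rightarrow> real" where
  "word_moment s w = expectation (\<lambda>\<omega>. mat 1 \<bullet> alt_prod s (map (\<lambda>A. A \<omega>) w))"

definition schatten_norm :: "nat \<Rightarrow> ('a \<Rightarrow> complex ^ 'd ^ 'd) \<Rightarrow> real" where
  "schatten_norm k A = root (2 * k) (word_moment True (replicate (2 * k) A))"

lemma word_moment_integrable:
  assumes "\<And>A. A \<in> set w \<Longrightarrow> ess_bounded A"
  shows "integrable M (\<lambda>\<omega>. mat 1 \<bullet> alt_prod s (map (\<lambda>A. A \<omega>) w))"
  using assms by (intro ess_bounded_integrable ess_bounded_inner ess_bounded_alt_prod ess_bounded_const)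

lemma word_moment_rotate1:
  "even (length w) \<Longrightarrow> word_moment s w = word_moment (\<not> s) (rotate1 w)"
  unfolding word_moment_def rotate1_map[symmetric]
  by (intro Bochner_Integration.integral_cong refl trace_alt_prod_rotate1) simp

lemma word_moment_append:
  assumes "length u = k"
  shows "word_moment s (u @ v) = expectation (\<lambda>\<omega>.
    alt_prod (s \<noteq> odd k) (map (\<lambda>A. A \<omega>) (rev u)) \<bullet> alt_prod (s \<noteq> odd k) (map (\<lambda>A. A \<omega>) v))"
  unfolding word_moment_def map_append rev_map[symmetric]
  using assms by (intro Bochner_Integration.integral_cong refl trace_alt_prod_append) simp

lemma word_moment_rev_append:
  assumes "length v = k"
  shows "word_moment s (rev v @ v) = expectation (\<lambda>\<omega>. (norm (alt_prod (s \<noteq> odd k) (map (\<lambda>A. A \<omega>) v)))\<^sup>2)"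
  using word_moment_append[of "rev v" k s v] assms by (simp add: power2_norm_eq_inner)

lemma word_moment_rev_append_nonneg: "0 \<le> word_moment s (rev v @ v)"
  by (subst word_moment_rev_append[OF refl]) (auto intro: integral_nonneg_AE)

text \<open>Cauchy-Schwarz for the two half-words. Both factors on the right are expected squared
  norms of half-words.\<close>

lemma word_moment_reflection:
  assumes "\<And>A. A \<in> set (u @ v) \<Longrightarrow> ess_bounded A" "length u = k" "length v = k"
  shows "(word_moment s (u @ v))\<^sup>2 \<le> word_moment s (u @ rev u) * word_moment s (rev v @ v)"
proof -
  have len: "length (rev u) = k" using assms(2) by simp
  have "(word_moment s (u @ v))\<^sup>2
     \<le> word_moment s (rev (rev u) @ rev u) * word_moment s (rev v @ v)"
    unfolding word_moment_append[OF assms(2)] word_moment_rev_append[OF assms(3)] word_moment_rev_append[OF len]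
    by (rule expectation_inner_Cauchy_Schwarz) (use assms(1) in auto)
  then show ?thesis by simp
qed

lemma replicate_double: "replicate (2 * k) A = rev (replicate k A) @ replicate k A"
  by (simp only: mult_2 replicate_add rev_replicate)

lemma word_moment_replicate_nonneg: "0 \<le> word_moment s (replicate (2 * k) A)"
  unfolding replicate_double by (rule word_moment_rev_append_nonneg)

lemma rotate1_replicate: "rotate1 (replicate n a) = replicate n a"
  by (cases n) (auto simp: replicate_append_same)

text \<open>Rotation flips the flag and fixes a constant word.\<close>

lemma word_moment_replicate: "word_moment s (replicate (2 * k) A) = word_moment True (replicate (2 * k) A)"
  using word_moment_rotate1[of "replicate (2 * k) A" False]
  by (cases s) (auto simp: rotate1_replicate)

lemma schatten_norm_nonneg [simp]: "0 \<le> schatten_norm k A"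
  by (simp add: schatten_norm_def word_moment_replicate_nonneg real_root_pos_pos_le)

lemma schatten_norm_power:
  "k > 0 \<Longrightarrow> schatten_norm k A ^ (2 * k) = word_moment s (replicate (2 * k) A)"
  unfolding schatten_norm_def word_moment_replicate[of s]
  by (rule real_root_pow_pos2) (simp_all add: word_moment_replicate_nonneg)

text \<open>Schatten-Hoelder inequality with all exponents equal to 2 k, obtained from
  \<open>reflection_bound\<close> with \<open>schatten_norm k\<close> as the weight of a
  letter.\<close>

lemma word_moment_Hoelder:
  fixes w :: "('a \<Rightarrow> complex ^ 'd ^ 'd) list"
  assumes k: "k > 0" and w: "\<And>A. A \<in> set w \<Longrightarrow> ess_bounded A" "length w = 2 * k"
  shows "\<bar>word_moment s w\<bar> \<le> prod_list (map (schatten_norm k) w)"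
proof -
  \<comment> \<open>A rotation flips the flag, so only the maximum over both flags is rotation
    invariant.\<close>
  define F where "F w = max \<bar>word_moment s w\<bar> \<bar>word_moment (\<not> s) w\<bar>" for w :: "('a \<Rightarrow> complex ^ 'd ^ 'd) list"
  have "F w \<le> prod_list (map (schatten_norm k) w)"
  proof (rule reflection_bound[where S = "Collect ess_bounded" and k = k])
    fix u v :: "('a \<Rightarrow> complex ^ 'd ^ 'd) list"
    assume uv: "u \<in> lists (Collect ess_bounded)" "v \<in> lists (Collect ess_bounded)" "length u = k" "length v = k"
    have mem: "ess_bounded A" if "A \<in> set (u @ v)" for A
      using that uv(1,2) unfolding in_lists_conv_set set_append by blast
    have le: "\<bar>word_moment s' (u @ v)\<bar>\<^sup>2 \<le> F (u @ rev u) * F (rev v @ v)" if "s' = s \<or> s' = (\<not> s)" for s'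
    proof -
      have "(word_moment s' (u @ v))\<^sup>2 \<le> word_moment s' (u @ rev u) * word_moment s' (rev v @ v)"
        using mem uv(3,4) by (rule word_moment_reflection)
      also have "\<dots> \<le> F (u @ rev u) * F (rev v @ v)"
        using that word_moment_rev_append_nonneg[of s' v]
        by (intro mult_mono) (auto simp: F_def)
      finally show ?thesis by simp
    qed
    show "(F (u @ v))\<^sup>2 \<le> F (u @ rev u) * F (rev v @ v)"
      using le[of s] le[of "\<not> s"] unfolding F_def[of "u @ v"] by (auto simp: max_def)
  next
    fix u :: "('a \<Rightarrow> complex ^ 'd ^ 'd) list"
    assume "length u = 2 * k"
    then show "F (rotate1 u) = F u"
      using word_moment_rotate1[of u s] word_moment_rotate1[of u "\<not> s"] by (simp add: F_def max.commute)
  next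
    fix A :: "'a \<Rightarrow> complex ^ 'd ^ 'd"
    show "F (replicate (2 * k) A) \<le> schatten_norm k A ^ (2 * k)"
      using schatten_norm_power[OF k, of A s] schatten_norm_power[OF k, of A "\<not> s"]
        word_moment_replicate_nonneg[of s k A] word_moment_replicate_nonneg[of "\<not> s" k A]
      by (simp add: F_def)
  qed (use k w in \<open>auto simp: F_def\<close>)
  then show ?thesis by (simp add: F_def)
qed

lemma schatten_norm_scaleR:
  assumes "k > 0"
  shows "schatten_norm k (\<lambda>\<omega>. c *\<^sub>R A \<omega>) = \<bar>c\<bar> * schatten_norm k A"
proof -
  have "word_moment True (replicate (2 * k) (\<lambda>\<omega>. c *\<^sub>R A \<omega>)) = c ^ (2 * k) * word_moment True (replicate (2 * k) A)"
    unfolding word_moment_def by (simp add: alt_prod_replicate_scaleR)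
  then have "schatten_norm k (\<lambda>\<omega>. c *\<^sub>R A \<omega>) ^ (2 * k) = (\<bar>c\<bar> * schatten_norm k A) ^ (2 * k)"
    by (simp add: schatten_norm_power[OF assms, of _ True] power_mult_distrib power_even_abs)
  then show ?thesis
    using assms by (simp add: power_eq_iff_eq_base)
qed

text \<open>When both powers are expanded and added, words with an odd number of \<open>Y\<close>
  cancel and the others get coefficient 2. Hoelder therefore applies word by word and leaves the
  scalar expression of \<open>two_point_power_le\<close>.\<close>

lemma schatten_norm_two_point:
  assumes k: "k > 0" and XY: "ess_bounded X" "ess_bounded Y"
  shows "(schatten_norm k (\<lambda>\<omega>. X \<omega> + Y \<omega>))\<^sup>2 + (schatten_norm k (\<lambda>\<omega>. X \<omega> - Y \<omega>))\<^sup>2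
    \<le> 2 * ((schatten_norm k X)\<^sup>2 + (2 * real k - 1) * (schatten_norm k Y)\<^sup>2)"
proof -
  define x where "x = schatten_norm k X"
  define y where "y = schatten_norm k Y"
  define letters where "letters w = map (\<lambda>b. if b then Y else X) w" for w
  have letters: "ess_bounded A" if "A \<in> set (letters w)" for A w
    using that XY by (auto simp: letters_def split: if_splits)
  have expand: "schatten_norm k (\<lambda>\<omega>. X \<omega> + c *\<^sub>R Y \<omega>) ^ (2 * k)
      = (\<Sum>w | length w = 2 * k. c ^ count_list w True * word_moment True (letters w))" for c
  proof -
    have "map (\<lambda>A. A \<omega>) (letters w) = map (\<lambda>b. if b then Y \<omega> else X \<omega>) w" for \<omega> w
      by (auto simp: letters_def)
    then have "schatten_norm k (\<lambda>\<omega>. X \<omega> + c *\<^sub>R Y \<omega>) ^ (2 * k) = expectation (\<lambda>\<omega>.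
       \<Sum>w | length w = 2 * k. c ^ count_list w True * (mat 1 \<bullet> alt_prod True (map (\<lambda>A. A \<omega>) (letters w))))"
      unfolding schatten_norm_power[OF k, of _ True] word_moment_def
      by (simp add: alt_prod_replicate_add inner_sum_right)
    also have "\<dots> = (\<Sum>w | length w = 2 * k. c ^ count_list w True * word_moment True (letters w))"
      unfolding word_moment_def
      by (subst Bochner_Integration.integral_sum)
        (simp_all add: word_moment_integrable[OF letters])
    finally show ?thesis .
  qed
  have "schatten_norm k (\<lambda>\<omega>. X \<omega> + 1 *\<^sub>R Y \<omega>) ^ (2 * k) + schatten_norm k (\<lambda>\<omega>. X \<omega> + (-1) *\<^sub>R Y \<omega>) ^ (2 * k)
      = (\<Sum>w | length w = 2 * k. (1 + (-1) ^ count_list w True) * word_moment True (letters w))"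
    unfolding expand by (simp add: sum.distrib distrib_right)
  also have "\<dots> \<le> (\<Sum>w | length w = 2 * k. (1 + (-1) ^ count_list w True) * prod_list (map (\<lambda>t. if t then y else x) w))"
  proof (intro sum_mono mult_left_mono)
    fix w :: "bool list" assume "w \<in> {w. length w = 2 * k}"
    then have "length (letters w) = 2 * k" by (simp add: letters_def)
    then have "word_moment True (letters w) \<le> prod_list (map (schatten_norm k) (letters w))"
      by (intro order_trans[OF abs_ge_self word_moment_Hoelder] k letters)
    also have "map (schatten_norm k) (letters w) = map (\<lambda>t. if t then y else x) w"
      by (auto simp: letters_def x_def y_def)
    finally show "word_moment True (letters w) \<le> prod_list (map (\<lambda>t. if t then y else x) w)" .
    show "(0::real) \<le> 1 + (-1) ^ count_list w True"
      by (cases "even (count_list w True)") auto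
  qed
  also have "\<dots> = (x + 1 * y) ^ (2 * k) + (x + (-1) * y) ^ (2 * k)"
    unfolding power_add_eq_sum_words by (simp add: sum.distrib distrib_right)
  finally have le: "schatten_norm k (\<lambda>\<omega>. X \<omega> + Y \<omega>) ^ (2 * k) + schatten_norm k (\<lambda>\<omega>. X \<omega> - Y \<omega>) ^ (2 * k)
      \<le> (x + y) ^ (2 * k) + (x - y) ^ (2 * k)" by simp
  define a where "a = (schatten_norm k (\<lambda>\<omega>. X \<omega> + Y \<omega>))\<^sup>2"
  define b where "b = (schatten_norm k (\<lambda>\<omega>. X \<omega> - Y \<omega>))\<^sup>2"
  \<comment> \<open>Convexity of the \<open>k\<close>-th power passes from the mean of 2k-th powers
    to the mean of squares.\<close>
  have cvx: "convex_on {0::real..} (\<lambda>x. x ^ k)"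
    using convex_power_even convex_power_odd by (cases "even k") (auto intro: convex_on_subset)
  have "((1/2) *\<^sub>R a + (1/2) *\<^sub>R b) ^ k \<le> (1/2) * a ^ k + (1/2) * b ^ k"
    using convex_onD[OF cvx, of "1/2" a b] by (simp add: a_def b_def)
  also have "\<dots> \<le> ((x + y) ^ (2 * k) + (x - y) ^ (2 * k)) / 2"
    using le by (simp add: a_def b_def power_mult)
  also have "\<dots> \<le> (x\<^sup>2 + (2 * real k - 1) * y\<^sup>2) ^ k"
    by (rule two_point_power_le[OF k])
  finally have pow: "((1/2) *\<^sub>R a + (1/2) *\<^sub>R b) ^ k \<le> (x\<^sup>2 + (2 * real k - 1) * y\<^sup>2) ^ k" .
  have "(1/2) *\<^sub>R a + (1/2) *\<^sub>R b \<le> x\<^sup>2 + (2 * real k - 1) * y\<^sup>2"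
  proof (rule power_le_imp_le_base[where n = "k - 1"])
    show "((1/2) *\<^sub>R a + (1/2) *\<^sub>R b) ^ Suc (k - 1) \<le> (x\<^sup>2 + (2 * real k - 1) * y\<^sup>2) ^ Suc (k - 1)"
      using pow k by simp
    show "0 \<le> x\<^sup>2 + (2 * real k - 1) * y\<^sup>2"
      using k by (intro add_nonneg_nonneg mult_nonneg_nonneg) auto
  qed
  then show ?thesis by (simp add: a_def b_def x_def y_def)
qed

text \<open>Replacing \<open>Y\<close> by \<open>h Y\<close> and letting \<open>h \<rightarrow> 0\<close> removes the factor 2 that symmetrization costs.\<close>

lemma schatten_norm_smooth:
  assumes k: "k > 0" and XY: "ess_bounded X" "ess_bounded Y"
    and orth: "word_moment True (replicate (2 * k - 1) X @ [Y]) = 0"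
  shows "(schatten_norm k (\<lambda>\<omega>. X \<omega> + Y \<omega>))\<^sup>2
    \<le> (schatten_norm k X)\<^sup>2 + (2 * real k - 1) * (schatten_norm k Y)\<^sup>2"
proof -
  define \<phi> where "\<phi> s = (schatten_norm k (\<lambda>\<omega>. X \<omega> + s *\<^sub>R Y \<omega>))\<^sup>2" for s
  have "\<phi> 1 \<le> \<phi> 0 + (2 * real k - 1) * (schatten_norm k Y)\<^sup>2"
  proof (rule tangent_parabola_bound)
    fix s h
    have "\<phi> (s + h) + \<phi> (s - h) \<le> 2 * (\<phi> s + (2 * real k - 1) * (schatten_norm k (\<lambda>\<omega>. h *\<^sub>R Y \<omega>))\<^sup>2)"
    proof -
      have "ess_bounded (\<lambda>\<omega>. X \<omega> + s *\<^sub>R Y \<omega>)" "ess_bounded (\<lambda>\<omega>. h *\<^sub>R Y \<omega>)"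
        using XY by auto
      from schatten_norm_two_point[OF k this] show ?thesis
        by (simp add: \<phi>_def scaleR_add_left scaleR_diff_left add.assoc add_diff_eq)
    qed
    then show "\<phi> (s + h) + \<phi> (s - h) \<le> 2 * \<phi> s + 2 * ((2 * real k - 1) * (schatten_norm k Y)\<^sup>2 * h\<^sup>2)"
      by (simp add: schatten_norm_scaleR[OF k] power_mult_distrib mult_ac)
  next
    \<comment> \<open>Minimality at 0: by \<open>orth\<close> the last letter \<open>X\<close> may
      be replaced by \<open>?S\<close> without changing the moment, and Hoelder followed by
      cancellation compares the two norms.\<close>
    fix s
    let ?S = "\<lambda>\<omega>. X \<omega> + s *\<^sub>R Y \<omega>"
    have rep: "replicate (2 * k) X = replicate (2 * k - 1) X @ [X]"
      using k by (cases k) (auto simp: replicate_append_same)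
    have "schatten_norm k X ^ (2 * k) = word_moment True (replicate (2 * k - 1) X @ [X])"
      by (simp add: schatten_norm_power[OF k, of X True] rep)
    also have "\<dots> = word_moment True (replicate (2 * k - 1) X @ [?S])"
    proof -
      have "word_moment True (replicate (2 * k - 1) X @ [?S])
          = expectation (\<lambda>\<omega>. mat 1 \<bullet> alt_prod True (map (\<lambda>A. A \<omega>) (replicate (2 * k - 1) X @ [X]))
              + s * (mat 1 \<bullet> alt_prod True (map (\<lambda>A. A \<omega>) (replicate (2 * k - 1) X @ [Y]))))"
        unfolding word_moment_def by (simp add: alt_prod_linear_last inner_add_right)
      also have "\<dots> = word_moment True (replicate (2 * k - 1) X @ [X]) + s * word_moment True (replicate (2 * k - 1) X @ [Y])"
        unfolding word_moment_def
      proof (subst Bochner_Integration.integral_add)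
        show "integrable M (\<lambda>\<omega>. mat 1 \<bullet> alt_prod True (map (\<lambda>A. A \<omega>) (replicate (2 * k - 1) X @ [X])))"
          by (rule word_moment_integrable) (use XY in auto)
        show "integrable M (\<lambda>\<omega>. s * (mat 1 \<bullet> alt_prod True (map (\<lambda>A. A \<omega>) (replicate (2 * k - 1) X @ [Y]))))"
          by (intro integrable_mult_right word_moment_integrable) (use XY in auto)
      qed simp
      finally show ?thesis using orth by simp
    qed
    also have "\<dots> \<le> prod_list (map (schatten_norm k) (replicate (2 * k - 1) X @ [?S]))"
      using XY k by (intro order_trans[OF abs_ge_self word_moment_Hoelder]) auto
    also have "\<dots> = schatten_norm k X ^ (2 * k - 1) * schatten_norm k ?S"
      by (simp add: prod_list_replicate)
    finally have "schatten_norm k X ^ (2 * k - 1) * schatten_norm k X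
        \<le> schatten_norm k X ^ (2 * k - 1) * schatten_norm k ?S"
      by (subst power_minus_mult) (use k in auto)
    then have "schatten_norm k X \<le> schatten_norm k ?S"
      by (cases "schatten_norm k X = 0") (auto simp: zero_less_power order_less_le)
    then show "\<phi> 0 \<le> \<phi> s" by (simp add: \<phi>_def power_mono)
  qed
  then show ?thesis by (simp add: \<phi>_def)
qed

end

section \<open>Rank-one matrices and the comparison of spectral and Schatten norms\<close>

definition outer_product :: "complex ^ 'n \<Rightarrow> complex ^ 'm \<Rightarrow> complex ^ 'm ^ 'n" where
  "outer_product y x = (\<chi> i j. y $ i * cnj (x $ j))"

lemma ctranspose_outer_product: "ctranspose (outer_product y x) = outer_product x y"
  by (simp add: ctranspose_def outer_product_def vec_eq_iff mult.commute)

lemma matrix_mult_outer_product: "A ** outer_product y x = outer_product (A *v y) x"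
  by (simp add: outer_product_def vec_eq_iff matrix_matrix_mult_def matrix_vector_mult_def
      sum_distrib_right mult.assoc)

lemma sum_cnj_mult_self: "(\<Sum>l\<in>UNIV. cnj (x $ l) * x $ l) = complex_of_real ((norm x)\<^sup>2)"
proof -
  have "(norm x)\<^sup>2 = (\<Sum>l\<in>UNIV. (cmod (x $ l))\<^sup>2)"
    by (simp add: norm_vec_def L2_set_def sum_nonneg)
  moreover have "cnj z * z = complex_of_real ((cmod z)\<^sup>2)" for z
    by (metis complex_norm_square mult.commute)
  ultimately show ?thesis by simp
qed

lemma outer_product_mult:
  "outer_product y x ** outer_product x z = (norm x)\<^sup>2 *\<^sub>R outer_product y z"
proof -
  have "(\<Sum>l\<in>UNIV. y $ i * cnj (x $ l) * (x $ l * cnj (z $ j))) = (norm x)\<^sup>2 *\<^sub>R (y $ i * cnj (z $ j))" for i j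
  proof -
    have "(\<Sum>l\<in>UNIV. y $ i * cnj (x $ l) * (x $ l * cnj (z $ j)))
        = (y $ i * cnj (z $ j)) * (\<Sum>l\<in>UNIV. cnj (x $ l) * x $ l)"
      by (simp add: sum_distrib_left mult_ac)
    then show ?thesis unfolding sum_cnj_mult_self by (simp add: scaleR_conv_of_real mult_ac)
  qed
  then show ?thesis by (simp add: outer_product_def vec_eq_iff matrix_matrix_mult_def)
qed

lemma trace_outer_product:
  fixes x :: "complex ^ 'd"
  shows "mat 1 \<bullet> outer_product x x = (norm x)\<^sup>2"
proof -
  have "mat 1 \<bullet> outer_product x x = Re (\<Sum>l\<in>UNIV. cnj (x $ l) * x $ l)"
  proof -
    have "(mat 1 :: complex ^ 'd ^ 'd) $ i $ j \<bullet> z = (if i = j then Re z else 0)" for i j z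
      by (simp add: mat_def inner_complex_def)
    then show ?thesis by (simp add: inner_vec_def outer_product_def algebra_simps)
  qed
  then show ?thesis unfolding sum_cnj_mult_self by simp
qed

text \<open>For V = y x^* the product V^* V is |y|^2 x x^*, and x x^* is a projection since
  \<open>x\<close> is a unit vector.\<close>

lemma alt_prod_outer_product:
  assumes "norm x = 1" "k > 0"
  shows "alt_prod True (replicate (2 * k) (outer_product y x)) = (norm y) ^ (2 * k) *\<^sub>R outer_product x x"
  using assms(2)
proof (induction k rule: nat_induct_non_zero)
  case 1
  then show ?case
    by (simp add: numeral_2_eq_2 ctranspose_outer_product outer_product_mult)
next
  case (Suc k)
  have "alt_prod True (replicate (2 * Suc k) (outer_product y x))
      = outer_product x y ** outer_product y x ** alt_prod True (replicate (2 * k) (outer_product y x))"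
    by (simp add: ctranspose_outer_product matrix_mul_assoc)
  also have "\<dots> = (norm y ^ (2 * k) * (norm y)\<^sup>2) *\<^sub>R outer_product x x"
    unfolding Suc outer_product_mult
    by (simp add: bounded_bilinear.scaleR_left[OF bounded_bilinear_matrix_mult]
        bounded_bilinear.scaleR_right[OF bounded_bilinear_matrix_mult] outer_product_mult assms(1))
  also have "\<dots> = norm y ^ (2 * Suc k) *\<^sub>R outer_product x x"
    by (simp add: power2_eq_square)
  finally show ?case .
qed

lemma continuous_on_ctranspose [continuous_intros]:
  "continuous_on S f \<Longrightarrow> continuous_on S (\<lambda>x. ctranspose (f x))"
  by (rule bounded_linear.continuous_on[OF bounded_linear_ctranspose])

lemma continuous_on_matrix_mult [continuous_intros]:
  fixes f g :: "_ \<Rightarrow> complex ^ 'd ^ 'd"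
  shows "continuous_on S f \<Longrightarrow> continuous_on S g \<Longrightarrow> continuous_on S (\<lambda>x. f x ** g x)"
  by (rule bounded_bilinear.continuous_on[OF bounded_bilinear_matrix_mult])

lemma continuous_on_alt_prod:
  "continuous_on S f \<Longrightarrow> continuous_on S (\<lambda>x. alt_prod s (replicate n (f x)))"
proof (induction n arbitrary: s)
  case (Suc n)
  then show ?case by (cases s) (auto intro!: continuous_intros)
qed simp

context prob_space
begin

text \<open>On constant random matrices \<open>schatten_norm\<close> is the usual Schatten 2k-norm,
  so the Hoelder inequality above also covers fixed matrices.\<close>

lemma schatten_norm_const_power:
  assumes "k > 0"
  shows "schatten_norm k (\<lambda>_. A) ^ (2 * k) = mat 1 \<bullet> alt_prod True (replicate (2 * k) A)"
  by (simp add: schatten_norm_power[OF assms, of _ True] word_moment_def prob_space)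

text \<open>The compression V = A x x^* has rank one and Schatten norm \<open>q\<close>. In the
  trace of its word the projection from the first letter moves cyclically to the end and is absorbed
  there, so the first \<open>V\<close> becomes \<open>A\<close>, and Hoelder gives q^(2 k) \<le> |A|
  q^(2 k - 1), with |A| the Schatten norm.\<close>

lemma norm_mult_vec_le_schatten_norm:
  assumes k: "k > 0" and x: "norm x = 1"
  shows "norm (A *v x) \<le> schatten_norm k (\<lambda>_. A)"
proof -
  define V where "V = outer_product (A *v x) x"
  define q where "q = norm (A *v x)"
  have VA: "V = A ** outer_product x x"
    by (simp add: V_def matrix_mult_outer_product)
  have VE: "V ** outer_product x x = V"
    using x by (simp add: V_def outer_product_mult)
  define W where "W = alt_prod False (replicate (2 * k - 1) V)"
  \<comment> \<open>The odd length makes the last letter of \<open>W\<close> a \<open>V\<close>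
    without adjoint, which absorbs the projection on its right.\<close>
  have "2 * k - 1 = Suc (2 * (k - 1))" using k by simp
  then have "W = alt_prod False (replicate (2 * (k - 1)) V @ [V])"
    unfolding W_def by (simp only: replicate_append_same replicate_Suc)
  then have WE: "W ** outer_product x x = W"
    by (simp add: alt_prod_append matrix_mul_assoc[symmetric] VE)
  have rep: "replicate (2 * k) V = V # replicate (2 * k - 1) V"
    using k by (cases k) auto
  have V: "schatten_norm k (\<lambda>_. V) ^ (2 * k) = q ^ (2 * k)"
    unfolding schatten_norm_const_power[OF k] V_def
    using alt_prod_outer_product[OF x k] x by (simp add: trace_outer_product q_def)
  then have Vq: "schatten_norm k (\<lambda>_. V) = q"
    using k by (simp add: power_eq_iff_eq_base q_def)
  have "q ^ (2 * k) = mat 1 \<bullet> (ctranspose V ** W)"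
    using V by (simp add: schatten_norm_const_power[OF k] rep W_def)
  also have "\<dots> = mat 1 \<bullet> (outer_product x x ** (ctranspose A ** W))"
    by (simp add: VA ctranspose_mult ctranspose_outer_product matrix_mul_assoc)
  also have "\<dots> = mat 1 \<bullet> (ctranspose A ** (W ** outer_product x x))"
    by (subst trace_mult_commute) (simp add: matrix_mul_assoc)
  also have "\<dots> = word_moment True ((\<lambda>_. A) # replicate (2 * k - 1) (\<lambda>_. V))"
    unfolding WE by (simp add: word_moment_def W_def prob_space)
  also have "\<dots> \<le> prod_list (map (schatten_norm k) ((\<lambda>_. A) # replicate (2 * k - 1) (\<lambda>_. V)))"
    by (intro order_trans[OF abs_ge_self word_moment_Hoelder]) (use k in auto)
  also have "\<dots> = schatten_norm k (\<lambda>_. A) * q ^ (2 * k - 1)"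
    by (simp add: prod_list_replicate Vq)
  finally have "q * q ^ (2 * k - 1) \<le> schatten_norm k (\<lambda>_. A) * q ^ (2 * k - 1)"
    by (subst power_Suc[symmetric]) (use k in simp)
  then show ?thesis
    unfolding q_def[symmetric] by (cases "q = 0") (auto simp: q_def zero_less_power)
qed

lemma spectral_norm_le_schatten_norm:
  assumes "k > 0"
  shows "spectral_norm A \<le> schatten_norm k (\<lambda>_. A)"
  unfolding spectral_norm_def
proof (rule onorm_le)
  fix x
  show "norm (A *v x) \<le> schatten_norm k (\<lambda>_. A) * norm x"
  proof (cases "x = 0")
    case False
    define y where "y = x /\<^sub>R norm x"
    have y: "norm y = 1" "x = norm x *\<^sub>R y" using False by (simp_all add: y_def)
    have "A *v x = norm x *\<^sub>R (A *v y)"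
      by (subst y(2)) (rule linear_scale[OF bounded_linear.linear[OF matrix_vector_mul_bounded_linear]])
    then have "norm (A *v x) = norm (A *v y) * norm x" by simp
    also have "\<dots> \<le> schatten_norm k (\<lambda>_. A) * norm x"
      by (intro mult_right_mono norm_mult_vec_le_schatten_norm assms y(1)) simp
    finally show ?thesis .
  qed simp
qed

lemma spectral_norm_tail:
  assumes k: "k > 0" and A: "ess_bounded A" and u: "u > 0"
  shows "prob {\<omega> \<in> space M. u \<le> spectral_norm (A \<omega>)} \<le> (schatten_norm k A / u) ^ (2 * k)"
proof -
  let ?f = "\<lambda>\<omega>. mat 1 \<bullet> alt_prod True (map (\<lambda>A. A \<omega>) (replicate (2 * k) A))"
  have int: "integrable M ?f" by (rule word_moment_integrable) (use A in auto)
  have f: "?f \<omega> = schatten_norm k (\<lambda>_. A \<omega>) ^ (2 * k)" for \<omega>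
    by (simp add: schatten_norm_const_power[OF k])
  have f0: "0 \<le> ?f \<omega>" for \<omega> by (simp only: f) simp
  have "u ^ (2 * k) \<le> ?f \<omega>" if "u \<le> spectral_norm (A \<omega>)" for \<omega>
    unfolding f using that u spectral_norm_le_schatten_norm[OF k, of "A \<omega>"]
    by (intro power_mono) auto
  \<comment> \<open>Monotonicity asks for measurability of the larger set, here a level set of the
    integrable function \<open>?f\<close>.\<close>
  then have "prob {\<omega> \<in> space M. u \<le> spectral_norm (A \<omega>)} \<le> prob {\<omega> \<in> space M. u ^ (2 * k) \<le> ?f \<omega>}"
    using borel_measurable_integrable[OF int] by (intro finite_measure_mono) auto
  also have "\<dots> \<le> expectation ?f / u ^ (2 * k)"
    using u by (intro integral_Markov_inequality_measure[where A = "space M"] int AE_I2 f0) simp_all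
  also have "\<dots> = (schatten_norm k A / u) ^ (2 * k)"
    by (simp only: power_divide schatten_norm_power[OF k, of A True] word_moment_def)
  finally show ?thesis .
qed

text \<open>The 2k-th moment of V = C Z is the expected squared Frobenius norm of a half-word
  starting with \<open>V\<close>. Stripping \<open>C\<close> from this letter costs c^2 and leaves
  two letters \<open>Z\<close> among letters \<open>V\<close>; Hoelder and cancellation of the
  powers of \<open>v\<close> finish.\<close>

lemma schatten_norm_mult_le:
  assumes k: "k > 0" and CZ: "ess_bounded C" "ess_bounded Z"
    and c: "AE \<omega> in M. spectral_norm (C \<omega>) \<le> c" "c \<ge> 0"
  shows "schatten_norm k (\<lambda>\<omega>. C \<omega> ** Z \<omega>) \<le> c * schatten_norm k Z"
proof -
  define V where "V = (\<lambda>\<omega>. C \<omega> ** Z \<omega>)"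
  define r where "r = replicate (k - 1) V"
  define v where "v = schatten_norm k V"
  define z where "z = schatten_norm k Z"
  have V: "ess_bounded V" unfolding V_def using CZ by auto
  have [simp]: "0 \<le> v" "0 \<le> z" by (simp_all add: v_def z_def)
  have rep: "replicate k V = V # r" using k by (cases k) (auto simp: r_def)
  have len: "length (A # r) = k" for A using k by (simp add: r_def)
  have bdd: "ess_bounded A" if "A \<in> set (V # Z # r)" for A
    using that V CZ by (auto simp: r_def)
  \<comment> \<open>The flag \<open>odd k\<close> makes the half-word start without adjoint, so that
    \<open>C\<close> stands at its left end.\<close>
  have "v ^ (2 * k) = expectation (\<lambda>\<omega>. (norm (alt_prod False (map (\<lambda>A. A \<omega>) (V # r))))\<^sup>2)"
    unfolding v_def schatten_norm_power[OF k, of V "odd k"] replicate_double rep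
      word_moment_rev_append[OF len] by simp
  also have "\<dots> \<le> expectation (\<lambda>\<omega>. c\<^sup>2 * (norm (alt_prod False (map (\<lambda>A. A \<omega>) (Z # r))))\<^sup>2)"
  proof (rule integral_mono_AE)
    show "AE \<omega> in M. (norm (alt_prod False (map (\<lambda>A. A \<omega>) (V # r))))\<^sup>2
        \<le> c\<^sup>2 * (norm (alt_prod False (map (\<lambda>A. A \<omega>) (Z # r))))\<^sup>2"
      using c(1)
    proof eventually_elim
      case (elim \<omega>)
      have "norm (alt_prod False (map (\<lambda>A. A \<omega>) (V # r))) \<le> c * norm (alt_prod False (map (\<lambda>A. A \<omega>) (Z # r)))"
        using norm_matrix_mult_le[OF elim] by (simp add: V_def matrix_mul_assoc[symmetric])
      then show ?case
        by (metis norm_ge_zero power_mono power_mult_distrib)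
    qed
    show "integrable M (\<lambda>\<omega>. (norm (alt_prod False (map (\<lambda>A. A \<omega>) (V # r))))\<^sup>2)"
      unfolding power2_norm_eq_inner
      by (intro ess_bounded_integrable ess_bounded_inner ess_bounded_alt_prod bdd) auto
    show "integrable M (\<lambda>\<omega>. c\<^sup>2 * (norm (alt_prod False (map (\<lambda>A. A \<omega>) (Z # r))))\<^sup>2)"
      unfolding power2_norm_eq_inner
      by (intro integrable_mult_right ess_bounded_integrable ess_bounded_inner ess_bounded_alt_prod bdd) auto
  qed
  also have "\<dots> = c\<^sup>2 * word_moment (odd k) (rev (Z # r) @ (Z # r))"
    unfolding word_moment_rev_append[OF len] by simp
  also have "\<dots> \<le> c\<^sup>2 * prod_list (map (schatten_norm k) (rev (Z # r) @ (Z # r)))"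
    by (intro mult_left_mono order_trans[OF abs_ge_self word_moment_Hoelder[OF k]])
      (use bdd k in \<open>auto simp: r_def\<close>)
  also have "\<dots> = (c * z)\<^sup>2 * v ^ (2 * (k - 1))"
    by (simp add: r_def prod_list_replicate v_def z_def power_mult_distrib power2_eq_square
        mult_2 power_add)
  finally have le: "v\<^sup>2 * v ^ (2 * (k - 1)) \<le> (c * z)\<^sup>2 * v ^ (2 * (k - 1))"
    using k by (cases k) (auto simp: power2_eq_square)
  have "v \<le> c * z"
  proof (cases "v = 0")
    case False
    then have "0 < v ^ (2 * (k - 1))" by (simp add: zero_less_power order_less_le)
    then have "v\<^sup>2 \<le> (c * z)\<^sup>2"
      using le mult_le_cancel_right_pos by blast
    then show ?thesis by (rule power2_le_imp_le) (use c(2) in simp)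
  qed (use c(2) in simp)
  then show ?thesis by (simp add: v_def z_def V_def)
qed

text \<open>Coordinates with respect to \<open>Basis\<close> reduce this to the product rule for
  independent real variables.\<close>

lemma expectation_inner_indep_centered:
  fixes W :: "'a \<Rightarrow> 'b::euclidean_space" and U :: "'a \<Rightarrow> 'b"
  assumes ind: "indep_var borel W borel U" and g: "g \<in> borel_measurable borel"
    and bdd: "ess_bounded (\<lambda>\<omega>. g (W \<omega>))" "ess_bounded U"
  shows "expectation (\<lambda>\<omega>. g (W \<omega>) \<bullet> (U \<omega> - expectation U)) = 0"
proof -
  let ?D = "\<lambda>\<omega>. U \<omega> - expectation U"
  have D: "ess_bounded ?D" using bdd by auto
  have int: "integrable M (\<lambda>\<omega>. g (W \<omega>) \<bullet> b)" "integrable M (\<lambda>\<omega>. ?D \<omega> \<bullet> b)" for b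
    using bdd D by auto
  have zero: "expectation (\<lambda>\<omega>. ?D \<omega> \<bullet> b) = 0" for b
    using bdd by (simp add: integral_inner_left ess_bounded_integrable prob_space)
  have indb: "indep_var borel (\<lambda>\<omega>. g (W \<omega>) \<bullet> b) borel (\<lambda>\<omega>. ?D \<omega> \<bullet> b)" for b
    using indep_var_compose[OF ind, of "\<lambda>w. g w \<bullet> b" borel "\<lambda>u. (u - expectation U) \<bullet> b" borel] g
    by (simp add: comp_def)
  have "expectation (\<lambda>\<omega>. g (W \<omega>) \<bullet> ?D \<omega>) = expectation (\<lambda>\<omega>. \<Sum>b\<in>Basis. (g (W \<omega>) \<bullet> b) * (?D \<omega> \<bullet> b))"
    by (rule Bochner_Integration.integral_cong[OF refl euclidean_inner])
  also have "\<dots> = (\<Sum>b\<in>Basis. expectation (\<lambda>\<omega>. (g (W \<omega>) \<bullet> b) * (?D \<omega> \<bullet> b)))"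
    by (rule Bochner_Integration.integral_sum) (rule indep_var_integrable[OF indb int])
  also have "\<dots> = 0"
    by (simp only: indep_var_lebesgue_integral[OF indb int] zero) simp
  finally show ?thesis .
qed

text \<open>Uniform smoothness for one further factor \<open>U\<close>, with the second summand
  centered given \<open>W\<close>. Taking \<open>R\<close> to be 0 gives the recursion for the
  product, and \<open>R\<close> the mean of \<open>W\<close> the one for the centered
  product.\<close>

lemma schatten_norm_step:
  fixes U W :: "'a \<Rightarrow> complex ^ 'd ^ 'd"
  assumes k: "k > 0" and ind: "indep_var borel W borel U"
    and bdd: "ess_bounded W" "ess_bounded U"
    and m: "spectral_norm (expectation U) \<le> m" "m \<ge> 0"
    and s: "AE \<omega> in M. spectral_norm (U \<omega> - expectation U) \<le> s * m" "s * m \<ge> 0"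
  shows "(schatten_norm k (\<lambda>\<omega>. expectation U ** (W \<omega> - R) + (U \<omega> - expectation U) ** W \<omega>))\<^sup>2
    \<le> m\<^sup>2 * ((schatten_norm k (\<lambda>\<omega>. W \<omega> - R))\<^sup>2 + (2 * real k - 1) * s\<^sup>2 * (schatten_norm k W)\<^sup>2)"
proof -
  define X where "X = (\<lambda>\<omega>. expectation U ** (W \<omega> - R))"
  define Y where "Y = (\<lambda>\<omega>. (U \<omega> - expectation U) ** W \<omega>)"
  define D where "D = (\<lambda>\<omega>. U \<omega> - expectation U)"
  \<comment> \<open>The word X ... X Y is linear in U - E U; \<open>g\<close> collects everything
    that depends on \<open>W\<close> once that difference is isolated in the inner product.\<close>
  define g where "g w = ctranspose (alt_prod True (replicate (2 * k - 1) (expectation U ** (w - R)))) ** ctranspose w" for w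
  have bX: "ess_bounded X" and bY: "ess_bounded Y" and bD: "ess_bounded D"
    unfolding X_def Y_def D_def
    by (intro ess_bounded_matrix_mult ess_bounded_diff ess_bounded_const bdd)+
  have g: "g \<in> borel_measurable borel"
    unfolding g_def by (intro borel_measurable_continuous_onI continuous_intros continuous_on_alt_prod)
  have "ess_bounded (\<lambda>\<omega>. alt_prod True (map (\<lambda>A. A \<omega>) (replicate (2 * k - 1) X)))"
    by (rule ess_bounded_alt_prod) (use bX in auto)
  then have bg: "ess_bounded (\<lambda>\<omega>. g (W \<omega>))"
    unfolding g_def using bdd(1)
    by (intro ess_bounded_matrix_mult ess_bounded_linear[OF bounded_linear_ctranspose]) (simp_all add: X_def)
  have "mat 1 \<bullet> alt_prod True (map (\<lambda>A. A \<omega>) (replicate (2 * k - 1) X @ [Y])) = g (W \<omega>) \<bullet> (U \<omega> - expectation U)" for \<omega>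
  proof -
    have "mat 1 \<bullet> alt_prod True (map (\<lambda>A. A \<omega>) (replicate (2 * k - 1) X @ [Y]))
        = ctranspose (alt_prod True (replicate (2 * k - 1) (X \<omega>))) \<bullet> ((U \<omega> - expectation U) ** W \<omega>)"
      using k by (simp add: alt_prod_append trace_mult_eq_inner Y_def)
    also have "\<dots> = g (W \<omega>) \<bullet> (U \<omega> - expectation U)"
      by (subst inner_commute) (simp add: inner_matrix_mult_right g_def X_def inner_commute)
    finally show ?thesis .
  qed
  then have "word_moment True (replicate (2 * k - 1) X @ [Y]) = 0"
    unfolding word_moment_def using expectation_inner_indep_centered[OF ind g bg bdd(2)] by simp
  then have "(schatten_norm k (\<lambda>\<omega>. X \<omega> + Y \<omega>))\<^sup>2
      \<le> (schatten_norm k X)\<^sup>2 + (2 * real k - 1) * (schatten_norm k Y)\<^sup>2"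
    by (rule schatten_norm_smooth[OF k bX bY])
  also have "\<dots> \<le> (m * schatten_norm k (\<lambda>\<omega>. W \<omega> - R))\<^sup>2 + (2 * real k - 1) * (s * m * schatten_norm k W)\<^sup>2"
  proof (intro add_mono mult_left_mono power_mono)
    show "schatten_norm k X \<le> m * schatten_norm k (\<lambda>\<omega>. W \<omega> - R)"
      unfolding X_def by (rule schatten_norm_mult_le) (use k bdd m in auto)
    show "schatten_norm k Y \<le> s * m * schatten_norm k W"
      unfolding Y_def by (rule schatten_norm_mult_le) (use k bdd s bD in \<open>auto simp: D_def\<close>)
  qed (use k in auto)
  also have "\<dots> = m\<^sup>2 * ((schatten_norm k (\<lambda>\<omega>. W \<omega> - R))\<^sup>2 + (2 * real k - 1) * s\<^sup>2 * (schatten_norm k W)\<^sup>2)"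
    by (simp add: power_mult_distrib algebra_simps)
  finally show ?thesis by (simp add: X_def Y_def)
qed

lemma expectation_mult_indep:
  fixes U W :: "'a \<Rightarrow> complex ^ 'd ^ 'd"
  assumes ind: "indep_var borel W borel U" and bdd: "ess_bounded W" "ess_bounded U"
  shows "expectation (\<lambda>\<omega>. U \<omega> ** W \<omega>) = expectation U ** expectation W"
proof -
  define D where "D = expectation (\<lambda>\<omega>. (U \<omega> - expectation U) ** W \<omega>)"
  have bD: "ess_bounded (\<lambda>\<omega>. (U \<omega> - expectation U) ** W \<omega>)"
    by (intro ess_bounded_matrix_mult ess_bounded_diff ess_bounded_const bdd)
  \<comment> \<open>Pairing \<open>D\<close> with itself turns the matrix identity into the
    vanishing of a scalar expectation with a centered independent factor.\<close>
  have "D \<bullet> D = expectation (\<lambda>\<omega>. ((U \<omega> - expectation U) ** W \<omega>) \<bullet> D)"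
    unfolding D_def by (rule integral_inner_left[symmetric]) (use bD in auto)
  also have "\<dots> = expectation (\<lambda>\<omega>. (D ** ctranspose (W \<omega>)) \<bullet> (U \<omega> - expectation U))"
    by (simp add: inner_matrix_mult_right inner_commute)
  also have "\<dots> = 0"
    by (rule expectation_inner_indep_centered[OF ind, where g = "\<lambda>w. D ** ctranspose w"])
      (use bdd in \<open>auto intro!: borel_measurable_continuous_onI continuous_intros
        ess_bounded_linear[OF bounded_linear_ctranspose]\<close>)
  finally have D0: "D = 0" by simp
  have "expectation (\<lambda>\<omega>. U \<omega> ** W \<omega>)
      = expectation (\<lambda>\<omega>. (U \<omega> - expectation U) ** W \<omega> + expectation U ** W \<omega>)"
    by (simp add: bounded_bilinear.diff_left[OF bounded_bilinear_matrix_mult])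
  also have "\<dots> = D + expectation (\<lambda>\<omega>. expectation U ** W \<omega>)"
    unfolding D_def
    by (intro Bochner_Integration.integral_add ess_bounded_integrable bD ess_bounded_matrix_mult
        ess_bounded_const bdd(1))
  also have "expectation (\<lambda>\<omega>. expectation U ** W \<omega>) = expectation U ** expectation W"
    using bdd by (intro integral_bounded_linear
      bounded_bilinear.bounded_linear_right[OF bounded_bilinear_matrix_mult]) auto
  finally show ?thesis using D0 by simp
qed

end

section \<open>Choice of the exponent\<close>

text \<open>The optimal exponent \<open>p = ln t / v\<close> is rounded to a nearest even integer \<open>2 k\<close>. The error
  \<open>(2 k - p)\<^sup>2 \<le> 1\<close> is absorbed by the difference of \<open>(2 k)\<^sup>2\<close> and \<open>2 k (2 k - 1)\<close>.\<close>

lemma even_moment_tail_le: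
  fixes d v t :: real
  assumes v: "v > 0" and t: "t > 0" and lt: "ln t \<ge> 2 * v" and d: "d \<ge> 0"
  obtains k :: nat where "k > 0"
    "d * (exp ((2 * real k - 1) * v) / t\<^sup>2) ^ k \<le> d * exp (- (ln t)\<^sup>2 / (2 * v))"
proof -
  define p where "p = ln t / v"
  have p: "p \<ge> 2" using lt v by (simp add: p_def field_simps)
  define k where "k = nat \<lfloor>(p + 1) / 2\<rfloor>"
  have rk: "real k = of_int \<lfloor>(p + 1) / 2\<rfloor>" using p by (simp add: k_def)
  have k2: "2 * real k \<le> p + 1" and k2': "p - 1 < 2 * real k"
    unfolding rk using of_int_floor_le[of "(p + 1) / 2"] floor_less_iff[of "(p + 1) / 2" "\<lfloor>(p + 1) / 2\<rfloor> + 1"] by (simp_all add: field_simps)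
  then have k0: "k > 0" using p by (cases k) auto
  define a where "a = 2 * real k"
  have "(a - p)\<^sup>2 \<le> 1\<^sup>2"
    using k2 k2' by (intro abs_le_square_iff[THEN iffD1]) (auto simp: a_def)
  moreover have "1 \<le> a" using k0 by (simp add: a_def)
  ultimately have "(a - p)\<^sup>2 - a \<le> 0" by simp
  \<comment> \<open>Since ln t = p v, this is the difference between the exponent for
    \<open>k\<close> and the target -(ln t)^2 / (2 v).\<close>
  then have "v / 2 * ((a - p)\<^sup>2 - a) \<le> 0" using v by (intro mult_nonneg_nonpos) auto
  moreover have lp: "ln t = p * v" using v by (simp add: p_def)
  ultimately have ex: "real k * ((2 * real k - 1) * v - 2 * ln t) \<le> - (ln t)\<^sup>2 / (2 * v)"
    using v by (simp add: a_def power2_eq_square field_simps)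
  have "t\<^sup>2 = exp (2 * ln t)" using t by (simp add: exp_double)
  then have "(exp ((2 * real k - 1) * v) / t\<^sup>2) ^ k = exp (real k * ((2 * real k - 1) * v - 2 * ln t))"
    by (simp add: exp_diff[symmetric] exp_of_nat_mult[symmetric])
  with ex have "(exp ((2 * real k - 1) * v) / t\<^sup>2) ^ k \<le> exp (- (ln t)\<^sup>2 / (2 * v))" by simp
  then show ?thesis using that[OF k0] d by (simp add: mult_left_mono)
qed

lemma exp_minus_1_le: "0 \<le> x \<Longrightarrow> x \<le> 1 \<Longrightarrow> exp x - 1 \<le> exp 1 * (x::real)"
proof -
  assume x: "0 \<le> x" "x \<le> 1"
  have "1 - x \<le> exp (- x)" using exp_ge_add_one_self[of "-x"] by simp
  then have "exp x * (1 - x) \<le> exp x * exp (- x)" by (intro mult_left_mono) auto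
  then have "exp x - 1 \<le> exp x * x" by (simp add: exp_minus algebra_simps)
  also have "\<dots> \<le> exp 1 * x" using x by (intro mult_right_mono) auto
  finally show ?thesis .
qed

text \<open>The cost of rounding \<open>p\<close> down to the even integer 2 k. After taking
  logarithms the claim is ln (c / p) \<le> 1 - p / (2 k).\<close>

lemma power_rounding_le:
  fixes p :: real and k :: nat
  assumes k: "k > 0" and p: "2 * real k \<le> p" "p \<le> 2 * real k + 2"
  shows "((2 * real k - 1) / (exp 1 * p)) ^ k \<le> exp (- p / 2)"
proof -
  define c where "c = 2 * real k - 1"
  have c: "c \<ge> 1" "c < p" using k p by (auto simp: c_def)
  \<comment> \<open>The estimate ln x \<le> x - 1 at x = c / p suffices for k \<ge> 2, where the
    squared rounding error 4 is at most 2 k. For k = 1 it is too weak near p = 4, so ln 2 \<ge> 1/2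
    is used as well.\<close>
  have ln: "ln (c / p) \<le> 1 - p / (2 * real k)"
  proof (cases "k = 1")
    case True
    have p': "2 \<le> p" "p \<le> 4" using p True by auto
    have "1/2 \<le> ln (2 :: real)" using ln_le_minus_one[of "1/2 :: real"] by (simp add: ln_div)
    moreover have "1 - 2 / p \<le> ln p - ln 2"
      using ln_le_minus_one[of "2 / p"] p' by (simp add: ln_div)
    moreover have "(p - 1) * (p - 4) \<le> 0" using p' by (intro mult_nonneg_nonpos) auto
    then have "p / 2 - 1 \<le> 3 / 2 - 2 / p" using p' by (simp add: field_simps)
    ultimately have "ln (1 / p) \<le> 1 - p / 2" using p' by (simp add: ln_div)
    then show ?thesis using True by (simp add: c_def)
  next
    case False
    then have k2: "real k \<ge> 2" using k by simp
    have "ln (c / p) \<le> c / p - 1"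
      using ln_le_minus_one[of "c / p"] c by simp
    also have "\<dots> \<le> 1 - p / (2 * real k)"
    proof -
      have "(p - 2 * real k)\<^sup>2 \<le> 2\<^sup>2" using p by (intro power_mono) auto
      also have "\<dots> \<le> 2 * real k" using k2 by simp
      finally have "c * (2 * real k) + p * p \<le> 4 * real k * p"
        by (simp add: c_def power2_eq_square algebra_simps)
      then show ?thesis using c k2 by (simp add: field_simps)
    qed
    finally show ?thesis .
  qed
  have "((2 * real k - 1) / (exp 1 * p)) ^ k = exp (real k * (ln (c / p) - 1))"
    unfolding c_def[symmetric] using c by (simp add: exp_of_nat_mult exp_diff mult.commute)
  also have "real k * (ln (c / p) - 1) \<le> real k * (- p / (2 * real k))"
    using ln by (intro mult_left_mono) auto
  then have "exp (real k * (ln (c / p) - 1)) \<le> exp (- p / 2)" using k by simp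
  finally show ?thesis .
qed

text \<open>The exponent p = t^2 / (e^2 v) is rounded down to 2 k, and \<open>large\<close> ensures
  k \<ge> 1. The condition t \<le> e gives p v \<le> 1, so the exponential minus 1 can be replaced
  by a linear bound.\<close>

lemma even_moment_centered_tail_le:
  fixes d v t :: real
  assumes v: "v > 0" and t: "t > 0" "t \<le> exp 1" and d: "d \<ge> 0" and large: "2 \<le> t\<^sup>2 / ((exp 1)\<^sup>2 * v)"
  obtains k :: nat where "k > 0"
    "d * ((exp ((2 * real k - 1) * v) - 1) / t\<^sup>2) ^ k \<le> d * exp (- t\<^sup>2 / (2 * (exp 1)\<^sup>2 * v))"
proof -
  define p where "p = t\<^sup>2 / ((exp 1)\<^sup>2 * v)"
  have p: "p \<ge> 2" using large by (simp add: p_def)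
  have tp: "t\<^sup>2 = (exp 1)\<^sup>2 * (p * v)" using v by (simp add: p_def)
  have "t\<^sup>2 \<le> (exp 1)\<^sup>2" using t by (intro power_mono) auto
  then have pv: "p * v \<le> 1" unfolding tp by simp
  define k where "k = nat \<lfloor>p / 2\<rfloor>"
  have rk: "real k = of_int \<lfloor>p / 2\<rfloor>" using p by (simp add: k_def)
  have k2: "2 * real k \<le> p" and k2': "p \<le> 2 * real k + 2"
    unfolding rk using of_int_floor_le[of "p / 2"] floor_less_iff[of "p / 2" "\<lfloor>p / 2\<rfloor> + 1"] by (simp_all add: field_simps)
  have "1 \<le> \<lfloor>p / 2\<rfloor>" using p by simp
  then have k0: "k > 0" by (simp add: k_def)
  define x where "x = (2 * real k - 1) * v"
  have x: "0 \<le> x" using v k0 by (simp add: x_def)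
  have "x \<le> p * v" unfolding x_def using k2 v by (intro mult_right_mono) auto
  then have "x \<le> 1" using pv by simp
  have pos: "0 < p * v" using p v by simp
  have "(exp x - 1) / t\<^sup>2 \<le> exp 1 * x / t\<^sup>2"
    using exp_minus_1_le[OF x \<open>x \<le> 1\<close>] by (intro divide_right_mono) auto
  also have "\<dots> = (2 * real k - 1) / (exp 1 * p)"
    unfolding tp x_def using v p by (simp add: power2_eq_square)
  finally have "((exp x - 1) / t\<^sup>2) ^ k \<le> ((2 * real k - 1) / (exp 1 * p)) ^ k"
    using x by (intro power_mono) auto
  also have "\<dots> \<le> exp (- p / 2)" by (rule power_rounding_le[OF k0 k2 k2'])
  also have "- p / 2 = - t\<^sup>2 / (2 * (exp 1)\<^sup>2 * v)" by (simp add: p_def)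
  finally show ?thesis using that[OF k0] d by (simp add: mult_left_mono x_def)
qed

section \<open>Products of independent random matrices\<close>

lemma measurable_rev_prod:
  assumes "i \<le> n"
  shows "(\<lambda>y :: nat \<Rightarrow> complex ^ 'd ^ 'd. rev_prod y i) \<in> borel_measurable (PiM {1..n} (\<lambda>_. borel))"
  using assms
proof (induction i)
  case (Suc i)
  have "(\<lambda>y :: nat \<Rightarrow> complex ^ 'd ^ 'd. y (Suc i) ** rev_prod y i) \<in> borel_measurable (PiM {1..n} (\<lambda>_. borel))"
  proof (rule borel_measurable_continuous_Pair[where H = "(**)"])
    show "(\<lambda>y :: nat \<Rightarrow> complex ^ 'd ^ 'd. y (Suc i)) \<in> borel_measurable (PiM {1..n} (\<lambda>_. borel))"
      by (rule measurable_component_singleton) (use Suc in simp)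
    show "continuous_on UNIV (\<lambda>x :: (complex ^ 'd ^ 'd) \<times> (complex ^ 'd ^ 'd). fst x ** snd x)"
      by (intro continuous_intros)
  qed (use Suc in simp)
  then show ?case by simp
qed simp

lemma rev_prod_cong:
  assumes "\<And>j. 1 \<le> j \<Longrightarrow> j \<le> n \<Longrightarrow> A j = B j"
  shows "rev_prod A n = rev_prod B n"
  using assms by (induction n) auto

context prob_space
begin

text \<open>The product of the first \<open>i\<close> factors is a function of the block {1..i},
  which is independent of the disjoint block {i + 1}.\<close>

lemma indep_var_rev_prod:
  assumes ind: "indep_vars (\<lambda>_. borel) Y {1..n}" and i: "Suc i \<le> n"
  shows "indep_var borel (\<lambda>\<omega>. rev_prod (\<lambda>j. Y j \<omega>) i) borel (Y (Suc i))"
proof -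
  have "indep_var (PiM {1..i} (\<lambda>_. borel)) (\<lambda>\<omega>. restrict (\<lambda>j. Y j \<omega>) {1..i})
      (PiM {Suc i} (\<lambda>_. borel)) (\<lambda>\<omega>. restrict (\<lambda>j. Y j \<omega>) {Suc i})"
    by (rule indep_var_restrict[OF ind]) (use i in auto)
  from indep_var_compose[OF this measurable_rev_prod[OF order_refl] measurable_component_singleton[of "Suc i"]]
  have "indep_var borel ((\<lambda>y. rev_prod y i) \<circ> (\<lambda>\<omega>. restrict (\<lambda>j. Y j \<omega>) {1..i})) borel
      ((\<lambda>y. y (Suc i)) \<circ> (\<lambda>\<omega>. restrict (\<lambda>j. Y j \<omega>) {Suc i}))" by simp
  moreover have "(\<lambda>y. rev_prod y i) \<circ> (\<lambda>\<omega>. restrict (\<lambda>j. Y j \<omega>) {1..i}) = (\<lambda>\<omega>. rev_prod (\<lambda>j. Y j \<omega>) i)"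
    by (auto simp: fun_eq_iff intro!: rev_prod_cong)
  moreover have "(\<lambda>y. y (Suc i)) \<circ> (\<lambda>\<omega>. restrict (\<lambda>j. Y j \<omega>) {Suc i}) = Y (Suc i)"
    by (auto simp: fun_eq_iff)
  ultimately show ?thesis by simp
qed

text \<open>Multiplication by the identity turns the spectral bound into a Frobenius bound.\<close>

lemma spectral_norm_bounded_imp_ess_bounded:
  assumes "U \<in> borel_measurable M" "AE \<omega> in M. spectral_norm (U \<omega> - C) \<le> c"
  shows "ess_bounded U"
proof (rule ess_boundedI[OF assms(1)])
  show "AE \<omega> in M. norm (U \<omega>) \<le> c * norm (mat 1 :: complex ^ 'b ^ 'b) + norm C"
    using assms(2)
  proof eventually_elim
    case (elim \<omega>)
    have "norm (U \<omega> - C) \<le> c * norm (mat 1 :: complex ^ 'b ^ 'b)"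
      using norm_matrix_mult_le[OF elim, of "mat 1"] by simp
    moreover have "norm (U \<omega>) \<le> norm (U \<omega> - C) + norm C"
      using norm_triangle_ineq[of "U \<omega> - C" C] by simp
    ultimately show ?case by simp
  qed
qed

text \<open>The source of the dimension factor in the tails: the empty product is the
  identity.\<close>

lemma schatten_norm_mat_1:
  "k > 0 \<Longrightarrow> schatten_norm k (\<lambda>_. mat 1 :: complex ^ 'd ^ 'd) ^ (2 * k) = real CARD('d)"
proof -
  assume k: "k > 0"
  have "alt_prod s (replicate j (mat 1)) = (mat 1 :: complex ^ 'd ^ 'd)" for s j
    by (induction j arbitrary: s) auto
  moreover have "mat 1 \<bullet> (mat 1 :: complex ^ 'd ^ 'd) = real CARD('d)"
    by (simp add: inner_vec_def mat_def if_distrib[of "\<lambda>z. z \<bullet> _"] if_distrib[of "\<lambda>z. _ \<bullet> z"]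
        sum.delta cong: if_cong)
  ultimately show ?thesis by (simp add: schatten_norm_const_power[OF k])
qed

text \<open>Induction on the number of factors. The recursion of the centered norm closes because
  Q_(i+1) - 1 = (Q_i - 1) + c s^2 Q_i.\<close>

lemma random_product_bounds:
  fixes Y :: "nat \<Rightarrow> 'a \<Rightarrow> complex ^ 'd ^ 'd" and m \<sigma> :: "nat \<Rightarrow> real"
  assumes k: "k > 0"
    and ind: "indep_vars (\<lambda>_. borel) Y {1..n}"
    and m: "\<And>i. i \<in> {1..n} \<Longrightarrow> m i > 0"
      "\<And>i. i \<in> {1..n} \<Longrightarrow> spectral_norm (expectation (Y i)) \<le> m i"
    and \<sigma>: "\<And>i. i \<in> {1..n} \<Longrightarrow> AE \<omega> in M. spectral_norm (Y i \<omega> - expectation (Y i)) \<le> \<sigma> i * m i"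
    and i: "i \<le> n"
  defines "Z \<equiv> \<lambda>i \<omega>. rev_prod (\<lambda>j. Y j \<omega>) i"
    and "P \<equiv> \<lambda>i. (\<Prod>j=1..i. (m j)\<^sup>2)"
    and "Q \<equiv> \<lambda>i. (\<Prod>j=1..i. 1 + (2 * real k - 1) * (\<sigma> j)\<^sup>2)"
    and "\<delta> \<equiv> (schatten_norm k (\<lambda>_. mat 1 :: complex ^ 'd ^ 'd))\<^sup>2"
  shows "ess_bounded (Z i) \<and>
    (schatten_norm k (Z i))\<^sup>2 \<le> P i * Q i * \<delta> \<and>
    (schatten_norm k (\<lambda>\<omega>. Z i \<omega> - expectation (Z i)))\<^sup>2 \<le> P i * (Q i - 1) * \<delta>"
  using i
proof (induction i)
  case 0
  have "schatten_norm k (\<lambda>_. 0 :: complex ^ 'd ^ 'd) = 0"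
    using schatten_norm_scaleR[OF k, of 0 "\<lambda>_. 0 :: complex ^ 'd ^ 'd"] by simp
  then show ?case by (simp add: Z_def P_def Q_def \<delta>_def prob_space)
next
  case (Suc i)
  define c where "c = 2 * real k - 1"
  define U where "U = Y (Suc i)"
  define mu where "mu = m (Suc i)"
  define s where "s = \<sigma> (Suc i)"
  define R where "R = expectation (Z i)"
  have mem: "Suc i \<in> {1..n}" using Suc by simp
  have IH: "ess_bounded (Z i)" "(schatten_norm k (Z i))\<^sup>2 \<le> P i * Q i * \<delta>"
    "(schatten_norm k (\<lambda>\<omega>. Z i \<omega> - R))\<^sup>2 \<le> P i * (Q i - 1) * \<delta>"
    using Suc by (auto simp: R_def)
  have c: "0 \<le> c" using k by (simp add: c_def)
  have mu: "mu > 0" "spectral_norm (expectation U) \<le> mu"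
    using m[OF mem] by (simp_all add: mu_def U_def)
  have s: "AE \<omega> in M. spectral_norm (U \<omega> - expectation U) \<le> s * mu"
    using \<sigma>[OF mem] by (simp add: mu_def U_def s_def)
  \<comment> \<open>A nonnegative norm is almost surely at most s mu, and an event of probability 1
    is not empty.\<close>
  have s0: "0 \<le> s * mu"
  proof -
    have "AE \<omega> in M. 0 \<le> s * mu"
      using s by eventually_elim
        (metis onorm_pos_le[OF matrix_vector_mul_bounded_linear] order_trans spectral_norm_def)
    then show ?thesis by simp
  qed
  have U: "ess_bounded U"
    using ind mem s by (intro spectral_norm_bounded_imp_ess_bounded) (auto simp: indep_vars_def U_def)
  have ZS: "Z (Suc i) = (\<lambda>\<omega>. U \<omega> ** Z i \<omega>)" by (simp add: Z_def U_def)
  have iv: "indep_var borel (Z i) borel U"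
    unfolding Z_def U_def by (rule indep_var_rev_prod[OF ind]) (use Suc in simp)
  have ES: "expectation (Z (Suc i)) = expectation U ** R"
    unfolding ZS R_def by (rule expectation_mult_indep[OF iv IH(1) U])
  note step = schatten_norm_step[OF k iv IH(1) U mu(2) less_imp_le[OF mu(1)] s s0]
  interpret mm: bounded_bilinear "(**) :: complex ^ 'd ^ 'd \<Rightarrow> complex ^ 'd ^ 'd \<Rightarrow> _"
    by (rule bounded_bilinear_matrix_mult)
  have dec0: "expectation U ** (Z i \<omega> - 0) + (U \<omega> - expectation U) ** Z i \<omega> = Z (Suc i) \<omega>" for \<omega>
    by (simp add: ZS mm.diff_left)
  have dec: "expectation U ** (Z i \<omega> - R) + (U \<omega> - expectation U) ** Z i \<omega>
      = Z (Suc i) \<omega> - expectation (Z (Suc i))" for \<omega>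
    unfolding ES by (simp add: ZS mm.diff_left mm.diff_right)
  have PS: "P (Suc i) = mu\<^sup>2 * P i" and QS: "Q (Suc i) = (1 + c * s\<^sup>2) * Q i"
    by (simp_all add: P_def Q_def mu_def s_def c_def mult.commute)
  have cs: "0 \<le> c * s\<^sup>2" using c by simp
  have "(schatten_norm k (Z (Suc i)))\<^sup>2
      \<le> mu\<^sup>2 * ((schatten_norm k (Z i))\<^sup>2 + c * s\<^sup>2 * (schatten_norm k (Z i))\<^sup>2)"
    using step[of 0] unfolding dec0 by (simp add: c_def)
  also have "\<dots> \<le> mu\<^sup>2 * (P i * Q i * \<delta> + c * s\<^sup>2 * (P i * Q i * \<delta>))"
    by (intro mult_left_mono add_mono IH cs) auto
  also have "\<dots> = P (Suc i) * Q (Suc i) * \<delta>"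
    by (simp add: PS QS algebra_simps)
  finally have 1: "(schatten_norm k (Z (Suc i)))\<^sup>2 \<le> P (Suc i) * Q (Suc i) * \<delta>" .
  have "(schatten_norm k (\<lambda>\<omega>. Z (Suc i) \<omega> - expectation (Z (Suc i))))\<^sup>2
      \<le> mu\<^sup>2 * ((schatten_norm k (\<lambda>\<omega>. Z i \<omega> - R))\<^sup>2 + c * s\<^sup>2 * (schatten_norm k (Z i))\<^sup>2)"
    using step[of R] unfolding dec by (simp add: c_def)
  also have "\<dots> \<le> mu\<^sup>2 * (P i * (Q i - 1) * \<delta> + c * s\<^sup>2 * (P i * Q i * \<delta>))"
    by (intro mult_left_mono add_mono IH cs) auto
  also have "\<dots> = P (Suc i) * (Q (Suc i) - 1) * \<delta>"
    by (simp add: PS QS algebra_simps)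
  finally have 2: "(schatten_norm k (\<lambda>\<omega>. Z (Suc i) \<omega> - expectation (Z (Suc i))))\<^sup>2
      \<le> P (Suc i) * (Q (Suc i) - 1) * \<delta>" .
  have "ess_bounded (Z (Suc i))" unfolding ZS by (intro ess_bounded_matrix_mult U IH)
  with 1 2 show ?case by blast
qed

lemma random_product_tails:
  fixes Y :: "nat \<Rightarrow> 'a \<Rightarrow> complex ^ 'd ^ 'd" and m \<sigma> :: "nat \<Rightarrow> real"
  assumes k: "k > 0"
    and ind: "indep_vars (\<lambda>_. borel) Y {1..n}"
    and m: "\<And>i. i \<in> {1..n} \<Longrightarrow> m i > 0"
      "\<And>i. i \<in> {1..n} \<Longrightarrow> spectral_norm (expectation (Y i)) \<le> m i"
    and \<sigma>: "\<And>i. i \<in> {1..n} \<Longrightarrow> AE \<omega> in M. spectral_norm (Y i \<omega> - expectation (Y i)) \<le> \<sigma> i * m i"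
    and t: "t > 0"
  defines "Z \<equiv> \<lambda>\<omega>. rev_prod (\<lambda>j. Y j \<omega>) n"
    and "B \<equiv> \<Prod>i=1..n. m i"
    and "v \<equiv> \<Sum>i=1..n. (\<sigma> i)\<^sup>2"
  shows "prob {\<omega> \<in> space M. t * B \<le> spectral_norm (Z \<omega>)}
      \<le> real CARD('d) * (exp ((2 * real k - 1) * v) / t\<^sup>2) ^ k" (is ?upper)
    and "prob {\<omega> \<in> space M. t * B \<le> spectral_norm (Z \<omega> - expectation Z)}
      \<le> real CARD('d) * ((exp ((2 * real k - 1) * v) - 1) / t\<^sup>2) ^ k" (is ?centered)
proof -
  define P where "P = (\<Prod>j=1..n. (m j)\<^sup>2)"
  define Q where "Q = (\<Prod>j=1..n. 1 + (2 * real k - 1) * (\<sigma> j)\<^sup>2)"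
  define \<delta> where "\<delta> = (schatten_norm k (\<lambda>_. mat 1 :: complex ^ 'd ^ 'd))\<^sup>2"
  have Z: "ess_bounded Z" and b: "(schatten_norm k Z)\<^sup>2 \<le> P * Q * \<delta>"
      "(schatten_norm k (\<lambda>\<omega>. Z \<omega> - expectation Z))\<^sup>2 \<le> P * (Q - 1) * \<delta>"
    using random_product_bounds[OF k ind m \<sigma> order_refl]
    by (simp_all add: Z_def P_def Q_def \<delta>_def)
  have \<delta>k: "\<delta> ^ k = real CARD('d)"
    using schatten_norm_mat_1[OF k, where 'd = 'd] by (simp add: \<delta>_def power_mult)
  have B: "B > 0" "P = B\<^sup>2"
    using m by (auto simp: B_def P_def prod_power_distrib intro: prod_pos)
  \<comment> \<open>Each factor is bounded by 1 + x \<le> exp x.\<close>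
  have Q: "Q \<le> exp ((2 * real k - 1) * v)"
  proof -
    have "Q \<le> (\<Prod>j=1..n. exp ((2 * real k - 1) * (\<sigma> j)\<^sup>2))"
      unfolding Q_def using k by (intro prod_mono) auto
    then show ?thesis by (simp add: exp_sum v_def sum_distrib_left)
  qed
  \<comment> \<open>Both tails are one Markov estimate, used with \<open>q\<close> equal to the
    exponential and to the exponential minus 1.\<close>
  have tail: "prob {\<omega> \<in> space M. t * B \<le> spectral_norm (A \<omega>)} \<le> real CARD('d) * (q / t\<^sup>2) ^ k"
    if A: "ess_bounded A" and q: "(schatten_norm k A)\<^sup>2 \<le> P * q * \<delta>" for A and q
  proof -
    have "prob {\<omega> \<in> space M. t * B \<le> spectral_norm (A \<omega>)} \<le> (schatten_norm k A / (t * B)) ^ (2 * k)"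
      using t B by (intro spectral_norm_tail k A) simp
    also have "\<dots> = ((schatten_norm k A)\<^sup>2 / (t * B)\<^sup>2) ^ k"
      by (simp add: power_mult power_divide)
    also have "\<dots> \<le> (P * q * \<delta> / (t * B)\<^sup>2) ^ k"
      using q by (intro power_mono divide_right_mono) auto
    also have "P * q * \<delta> / (t * B)\<^sup>2 = \<delta> * (q / t\<^sup>2)"
      using B by (simp add: power_mult_distrib)
    finally show ?thesis unfolding power_mult_distrib \<delta>k .
  qed
  have nn: "0 \<le> P * \<delta>" by (simp add: B \<delta>_def)
  have mono: "P * x * \<delta> \<le> P * y * \<delta>" if "x \<le> y" for x y
    using mult_left_mono[OF that nn] by (simp add: mult_ac)
  show ?upper by (rule tail[OF Z order_trans[OF b(1) mono[OF Q]]])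
  show ?centered
    using Q by (intro tail order_trans[OF b(2) mono] ess_bounded_diff Z ess_bounded_const) simp
qed

end

theorem corollary5p6:
  fixes \<Omega> :: "'a measure"
    and Y :: "nat \<Rightarrow> 'a \<Rightarrow> complex ^ 'd ^ 'd"
    and Z :: "'a \<Rightarrow> complex ^ 'd ^ 'd"
    and m \<sigma> :: "nat \<Rightarrow> real"
    and M v :: real
    and n :: nat
  assumes "prob_space \<Omega>"
    and "prob_space.indep_vars \<Omega> (\<lambda>_. borel) Y {1..n}"
    and "\<And>i. i \<in> {1..n} \<Longrightarrow> m i > 0"
    and "\<And>i. i \<in> {1..n} \<Longrightarrow> spectral_norm (integral\<^sup>L \<Omega> (Y i)) \<le> m i"
    and "\<And>i. i \<in> {1..n} \<Longrightarrow>
      AE \<omega> in \<Omega>. spectral_norm (Y i \<omega> - integral\<^sup>L \<Omega> (Y i)) \<le> \<sigma> i * m i"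
    and "Z = (\<lambda>\<omega>. rev_prod (\<lambda>i. Y i \<omega>) n)"
    and "M = (\<Prod>i=1..n. m i)"
    and "v = (\<Sum>i=1..n. (\<sigma> i)\<^sup>2)"
  shows "(\<forall>t>0. ln t \<ge> 2 * v \<longrightarrow>
      measure \<Omega> {\<omega> \<in> space \<Omega>. spectral_norm (Z \<omega>) \<ge> t * M}
        \<le> real CARD('d) * exp (- (ln t)\<^sup>2 / (2 * v)))
    \<and> (\<forall>t\<ge>0. t \<le> exp 1 \<longrightarrow>
      measure \<Omega> {\<omega> \<in> space \<Omega>. spectral_norm (Z \<omega> - integral\<^sup>L \<Omega> Z) \<ge> t * M}
        \<le> max (real CARD('d)) (exp 1) * exp (- t\<^sup>2 / (2 * (exp 1)\<^sup>2 * v)))"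
proof -
  interpret prob_space \<Omega> by fact
  have upper: "prob {\<omega> \<in> space \<Omega>. spectral_norm (Z \<omega>) \<ge> t * M}
      \<le> real CARD('d) * (exp ((2 * real k - 1) * v) / t\<^sup>2) ^ k" if "k > 0" "t > 0" for k t
    unfolding assms(6-8) by (rule random_product_tails(1)[OF that(1) assms(2)]) (use assms(3-5) that in auto)
  have centered: "prob {\<omega> \<in> space \<Omega>. spectral_norm (Z \<omega> - expectation Z) \<ge> t * M}
      \<le> real CARD('d) * ((exp ((2 * real k - 1) * v) - 1) / t\<^sup>2) ^ k" if "k > 0" "t > 0" for k t
    unfolding assms(6-8) by (rule random_product_tails(2)[OF that(1) assms(2)]) (use assms(3-5) that in auto)
  have v: "0 \<le> v" unfolding assms(8) by (intro sum_nonneg) auto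
  have card: "1 \<le> real CARD('d)" using zero_less_card_finite[where 'a = 'd] by linarith
  show ?thesis
  proof (intro conjI allI impI)
    fix t :: real assume t: "t > 0" "ln t \<ge> 2 * v"
    show "prob {\<omega> \<in> space \<Omega>. spectral_norm (Z \<omega>) \<ge> t * M}
        \<le> real CARD('d) * exp (- (ln t)\<^sup>2 / (2 * v))"
    \<comment> \<open>For v = 0 the quotient is 0 by the convention for division by zero, so the
      right side is \<open>d\<close>, which is at least 1.\<close>
    proof (cases "v = 0")
      case True
      then show ?thesis using card order_trans[OF prob_le_1] by simp
    next
      case False
      then obtain k :: nat where "k > 0" "real CARD('d) * (exp ((2 * real k - 1) * v) / t\<^sup>2) ^ k
          \<le> real CARD('d) * exp (- (ln t)\<^sup>2 / (2 * v))"
        using even_moment_tail_le[of v t "real CARD('d)"] t v by auto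
      with upper[of k t] t(1) show ?thesis by linarith
    qed
  next
    fix t :: real assume t: "t \<ge> 0" "t \<le> exp 1"
    show "prob {\<omega> \<in> space \<Omega>. spectral_norm (Z \<omega> - expectation Z) \<ge> t * M}
        \<le> max (real CARD('d)) (exp 1) * exp (- t\<^sup>2 / (2 * (exp 1)\<^sup>2 * v))"
    \<comment> \<open>If the optimal exponent is below 2, no even moment is used: the exponential is
      then at least 1/e, and the prefactor max d e makes the bound at least 1. The cases t = 0 and v
      = 0 fall here too, as the quotient is then 0.\<close>
    proof (cases "t > 0 \<and> v > 0 \<and> 2 \<le> t\<^sup>2 / ((exp 1)\<^sup>2 * v)")
      case True
      then obtain k :: nat where k: "k > 0" "real CARD('d) * ((exp ((2 * real k - 1) * v) - 1) / t\<^sup>2) ^ k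
          \<le> real CARD('d) * exp (- t\<^sup>2 / (2 * (exp 1)\<^sup>2 * v))"
        using even_moment_centered_tail_le[of v t "real CARD('d)"] t by auto
      have "prob {\<omega> \<in> space \<Omega>. spectral_norm (Z \<omega> - expectation Z) \<ge> t * M}
          \<le> real CARD('d) * exp (- t\<^sup>2 / (2 * (exp 1)\<^sup>2 * v))"
        using centered[of k t] k True by linarith
      also have "\<dots> \<le> max (real CARD('d)) (exp 1) * exp (- t\<^sup>2 / (2 * (exp 1)\<^sup>2 * v))"
        by (intro mult_right_mono) auto
      finally show ?thesis .
    next
      case False
      then have "t\<^sup>2 / ((exp 1)\<^sup>2 * v) \<le> 2"
        using t v by (cases "t = 0"; cases "v = 0") auto
      then have "exp (- 1) \<le> exp (- t\<^sup>2 / (2 * (exp 1)\<^sup>2 * v))" by simp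
      then have "exp 1 * exp (- 1) \<le> max (real CARD('d)) (exp 1) * exp (- t\<^sup>2 / (2 * (exp 1)\<^sup>2 * v))"
        by (intro mult_mono) auto
      then show ?thesis
        using order_trans[OF prob_le_1] by (simp flip: exp_add)
    qed
  qed
qed

end
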